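(* Let $r\ge 0$ be an integer, let $\Theta_1,\dots,\Theta_n$ be i.i.d. circular random variables with density $f$, let $(K_\nu)$ be a circular kernel family, let $(\nu_n)$ be a sequence of smoothing parameters, write $h_n=h_K(\nu_n)$, and let $\hat f^{(r)}_{\nu}(\theta)=\frac1n\sum_{i=1}^n K_\nu^{(r)}(\theta-\Theta_i)$. Assume: (A1) $f^{(r+2)}$ is continuous and square-integrable on $[-\pi,\pi)$, and $\int_{-\pi}^{\pi}(f^{(r+2)}(\theta))^2d\theta>0$. (A2) $K$ is a bounded circular density, reflectively symmetric about zero, unimodal, and its $r$-th derivative is square-integrable on $[-\pi,\pi)$. (A3) As $n\to\infty$: $h_n\to0$, $R_{K;r,2}(\nu_n)\to\infty$ and $n^{-1}R_{K;r,2}(\nu_n)\to0$. (E1) $\int_{-\pi}^{\pi}\theta^4K_{\nu_n}(\theta)\,d\theta=o(h_n)$. (E2) $\int_{-\pi}^{\pi}\theta^2\big(K^{(r)}_{\nu_n}(\theta)\big)^2d\theta=o\big(R_{K;r,2}(\nu_n)\big)$. (E3) As $n$ increases, $R_{K;r,2}(\nu_n)=Q_{K;r,2}\,h_n^{-(2r+1)/2}$ (asymptotically), where $Q_{K;r,2}$ is a constant depending only on the kernel $K$ and $r$. Then, asymptotically, the AMISE-optimal value of $h_n$ for $\hat f^{(r)}_\nu$ is $$h_{K;r;\mathrm{AMISE}}=\left(\frac{(2r+1)Q_{K;r,2}}{n\int_{-\pi}^{\pi}(f^{(r+2)}(\theta))^2d\theta}\right)^{2/(2r+5)},$$ and the minimal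 AMISE is $$\inf_{0\le\nu<1}\mathrm{AMISE}\big[\hat f^{(r)}_\nu\big]=\frac{2r+5}{8r+4}\left(\frac{(2r+1)Q_{K;r,2}}{n\int_{-\pi}^{\pi}(f^{(r+2)}(\theta))^2d\theta}\right)^{4/(2r+5)}\int_{-\pi}^{\pi}\big(f^{(r+2)}(\theta)\big)^2d\theta.$$
   Context: Circular densities are regarded as $2\pi$-periodic functions on the real line (so continuity and derivatives are understood on the circle) that integrate to one over $[-\pi,\pi)$. A circular kernel family $K_\nu$ is a family of circular densities, symmetric about zero, unimodal and square-integrable, indexed by the smoothing parameter $\nu\in[0,1]$ (the mean resultant length), with convergent Fourier series $$K_\nu(\theta)=\frac1{2\pi}\Big(1+2\sum_{j=1}^\infty\alpha_{K,j}(\nu)\cos(j\theta)\Big),\qquad \alpha_{K,j}(\nu)\in[0,1].$$ Define $$h_K(\nu)=\frac{\pi^2}{3}+4\sum_{j=1}^\infty\frac{(-1)^j\alpha_{K,j}(\nu)}{j^2},$$ $$R_{K;0,2}(\nu)=\frac1{2\pi}\Big(1+2\sum_{j=1}^\infty\alpha_{K,j}^2(\nu)\Big),\qquad R_{K;r,2}(\nu)=\frac1\pi\sum_{j=1}^\infty j^{2r}\alpha_{K,j}^2(\nu)\quad (r\ge1).$$ $\mathrm{MISE}[\hat f^{(r)}_\nu]=\int_{-\pi}^{\pi}\mathbb E\big[(\hat f^{(r)}_\nu(\theta)-f^{(r)}(\theta))^2\big]d\theta$, and $\mathrm{AMISE}$ is its asymptotic leading part: under (A1)–(A3), (E1), (E2),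 $\mathrm{AMISE}[\hat f^{(r)}_{\nu_n}]=\frac14h_K^2(\nu_n)\int_{-\pi}^{\pi}(f^{(r+2)})^2+\frac1nR_{K;r,2}(\nu_n)$, meaning that MISE equals this up to $o\big(h_K^2(\nu_n)+n^{-1}R_{K;r,2}(\nu_n)\big)$. In the corollary, $R_{K;r,2}(\nu_n)$ in this expression is replaced by its asymptotic form from (E3) (asymptotic equality means the ratio of both sides tends to $1$), so that AMISE becomes a function of $h=h_K(\nu)>0$; "optimal" and "$\inf_{0\le\nu<1}$" refer to minimizing this function over $h>0$. *)

theory Defs
  imports "HOL-Probability.Probability" "HOL-Library.Landau_Symbols"
begin

definition circular_density :: "(real \<Rightarrow> real) \<Rightarrow> bool" where
  "circular_density g \<longleftrightarrow>
     g \<in> borel_measurable borel \<and> (\<forall>x. 0 \<le> g x) \<and> (\<forall>x. g (x + 2 * pi) = g x) \<and>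
     set_integrable lborel {-pi..<pi} g \<and> (LBINT x:{-pi..<pi}. g x) = 1"

definition circular_square_integrable :: "(real \<Rightarrow> real) \<Rightarrow> bool" where
  "circular_square_integrable g \<longleftrightarrow>
     g \<in> borel_measurable borel \<and> set_integrable lborel {-pi..<pi} (\<lambda>x. (g x)\<^sup>2)"

text \<open>On one full turn, from an antimode \<open>a\<close> to \<open>a + 2 * pi\<close>, the function first
  increases to a mode \<open>m\<close> and then decreases (weakly, so that the uniform density qualifies).\<close>

definition circular_unimodal :: "(real \<Rightarrow> real) \<Rightarrow> bool" where
  "circular_unimodal g \<longleftrightarrow>
     (\<exists>a m. a \<le> m \<and> m \<le> a + 2 * pi \<and> mono_on {a..m} g \<and> antimono_on {m..a + 2 * pi} g)"

definition symmetric_about_zero :: "(real \<Rightarrow> real) \<Rightarrow> bool" where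
  "symmetric_about_zero g \<longleftrightarrow> (\<forall>x. g (- x) = g x)"

definition mean_resultant_length :: "(real \<Rightarrow> real) \<Rightarrow> real" where
  "mean_resultant_length g = cmod (LBINT x:{-pi..<pi}. complex_of_real (g x) * cis x)"

text \<open>\<open>nth_deriv r g\<close> is meaningful only together with \<open>times_differentiable r g\<close>, since
  \<^const>\<open>deriv\<close> is unspecified at points of non-differentiability.\<close>

abbreviation nth_deriv :: "nat \<Rightarrow> (real \<Rightarrow> real) \<Rightarrow> real \<Rightarrow> real" where
  "nth_deriv r g \<equiv> (deriv ^^ r) g"

definition times_differentiable :: "nat \<Rightarrow> (real \<Rightarrow> real) \<Rightarrow> bool" where
  "times_differentiable r g \<longleftrightarrow> (\<forall>k<r. \<forall>x. nth_deriv k g field_differentiable (at x))"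

text \<open>The Fourier coefficient $\alpha_{K,j}(\nu)$: with this normalisation the Fourier series of
  an even density \<open>K \<nu>\<close> is $\frac{1}{2\pi}(1 + 2 \sum_{j \ge 1} \alpha_{K,j}(\nu) \cos(j\theta))$.\<close>

definition alpha :: "(real \<Rightarrow> real \<Rightarrow> real) \<Rightarrow> nat \<Rightarrow> real \<Rightarrow> real" where
  "alpha K j \<nu> = (LBINT x:{-pi..<pi}. K \<nu> x * cos (real j * x))"

text \<open>The endpoint \<open>\<nu> = 1\<close> is left out: a distribution with mean resultant length 1 is a point
  mass, so no density \<open>K 1\<close> exists. The values of \<open>K\<close> outside \<open>{0..<1}\<close> are irrelevant.\<close>

definition circular_kernel_family :: "(real \<Rightarrow> real \<Rightarrow> real) \<Rightarrow> bool" where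
  "circular_kernel_family K \<longleftrightarrow>
     (\<forall>\<nu>\<in>{0..<1}.
        circular_density (K \<nu>) \<and> symmetric_about_zero (K \<nu>) \<and> circular_unimodal (K \<nu>) \<and>
        circular_square_integrable (K \<nu>) \<and> mean_resultant_length (K \<nu>) = \<nu> \<and>
        (\<forall>j\<ge>1. alpha K j \<nu> \<in> {0..1}) \<and>
        (\<forall>\<theta>. summable (\<lambda>j. alpha K (Suc j) \<nu> * cos (real (Suc j) * \<theta>)) \<and>
             K \<nu> \<theta> = 1 / (2 * pi) *
               (1 + 2 * (\<Sum>j. alpha K (Suc j) \<nu> * cos (real (Suc j) * \<theta>)))))"

definition h_kernel :: "(real \<Rightarrow> real \<Rightarrow> real) \<Rightarrow> real \<Rightarrow> real" where
  "h_kernel K \<nu> = pi\<^sup>2 / 3 + 4 * (\<Sum>j. (-1) ^ Suc j * alpha K (Suc j) \<nu> / (real (Suc j))\<^sup>2)"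

definition R_kernel :: "(real \<Rightarrow> real \<Rightarrow> real) \<Rightarrow> nat \<Rightarrow> real \<Rightarrow> real" where
  "R_kernel K r \<nu> =
     (if r = 0 then 1 / (2 * pi) * (1 + 2 * (\<Sum>j. (alpha K (Suc j) \<nu>)\<^sup>2))
      else 1 / pi * (\<Sum>j. real (Suc j) ^ (2 * r) * (alpha K (Suc j) \<nu>)\<^sup>2))"

text \<open>Circular random variables are represented by their angle in \<open>{-pi..<pi}\<close>.\<close>

definition iid_circular_sample ::
  "'a measure \<Rightarrow> (nat \<Rightarrow> 'a \<Rightarrow> real) \<Rightarrow> (real \<Rightarrow> real) \<Rightarrow> bool" where
  "iid_circular_sample M X f \<longleftrightarrow>
     prob_space M \<and> prob_space.indep_vars M (\<lambda>_. borel) X UNIV \<and>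
     (\<forall>i. distributed M lborel (X i) (\<lambda>x. ennreal (indicator {-pi..<pi} x * f x)))"

definition kde_deriv ::
  "(real \<Rightarrow> real \<Rightarrow> real) \<Rightarrow> nat \<Rightarrow> (nat \<Rightarrow> 'a \<Rightarrow> real) \<Rightarrow> nat \<Rightarrow> real \<Rightarrow> real \<Rightarrow> 'a \<Rightarrow> real" where
  "kde_deriv K r X n \<nu> \<theta> \<omega> = 1 / real n * (\<Sum>i<n. nth_deriv r (K \<nu>) (\<theta> - X i \<omega>))"

definition MISE ::
  "'a measure \<Rightarrow> (nat \<Rightarrow> 'a \<Rightarrow> real) \<Rightarrow> (real \<Rightarrow> real) \<Rightarrow> (real \<Rightarrow> real \<Rightarrow> real) \<Rightarrow> nat \<Rightarrow> nat \<Rightarrow> real \<Rightarrow> real"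
  where
  "MISE M X f K r n \<nu> =
     (LBINT \<theta>:{-pi..<pi}. (LINT \<omega>|M. (kde_deriv K r X n \<nu> \<theta> \<omega> - nth_deriv r f \<theta>)\<^sup>2))"

definition integrated_sq_deriv :: "(real \<Rightarrow> real) \<Rightarrow> nat \<Rightarrow> real" where
  "integrated_sq_deriv f k = (LBINT x:{-pi..<pi}. (nth_deriv k f x)\<^sup>2)"

definition AMISE ::
  "(real \<Rightarrow> real) \<Rightarrow> (real \<Rightarrow> real \<Rightarrow> real) \<Rightarrow> nat \<Rightarrow> nat \<Rightarrow> real \<Rightarrow> real" where
  "AMISE f K r n \<nu> =
     1 / 4 * (h_kernel K \<nu>)\<^sup>2 * integrated_sq_deriv f (r + 2) + 1 / real n * R_kernel K r \<nu>"

text \<open>\<^const>\<open>AMISE\<close> as a function of \<open>h = h_kernel K \<nu>\<close> once \<^const>\<open>R_kernel\<close> is replaced by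
  its asymptotic form \<open>Q * h powr (- (2 * r + 1) / 2)\<close>.\<close>

definition AMISE_of_h :: "(real \<Rightarrow> real) \<Rightarrow> real \<Rightarrow> nat \<Rightarrow> nat \<Rightarrow> real \<Rightarrow> real" where
  "AMISE_of_h f Q r n h =
     1 / 4 * h\<^sup>2 * integrated_sq_deriv f (r + 2)
     + 1 / real n * (Q * h powr (- (2 * real r + 1) / 2))"

end

theory Submission
  imports Defs
begin

text \<open>For an i.i.d. sample the MISE splits exactly into $\int (\mu - f^{(r)})^2$ plus
  $\frac1n\big(\int (K_\nu^{(r)})^2 - \int \mu^2\big)$, where
  $\mu = K_\nu * f^{(r)}$ after $r$ integrations by parts. A second-order Taylor expansion, uniform in
  the base point because $f^{(r+2)}$ is uniformly continuous, gives
  $\mu - f^{(r)} = \frac12 h f^{(r+2)} + o(h)$ by (E1), and $\int \mu^2$ is bounded, hence negligible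
  against $R_{K;r,2} \to \infty$. The identity $R_{K;r,2} = \int (K_\nu^{(r)})^2$ needs no $L^2$ completeness:
  convergence at $\theta = 0$ makes the nonnegative Fourier coefficients of $K_\nu$ summable; Bessel's
  inequality for $K_\nu^{(r)}$ gives one half and lets $K_\nu^{(r-1)}$ be differentiated termwise, and
  Fatou's lemma applied to the difference quotients of $K_\nu^{(r-1)}$ gives the other. The minimisation in
  $h$ is the inequality $e^x \ge 1 + x$ applied twice after substituting $h = h_* e^s$.\<close>

subsection \<open>Integration over one period\<close>

text \<open>The obstacle is regularity. \<open>nth_deriv r (K v)\<close> is only measurable and
  square-integrable: it need not be bounded or continuous, and nothing says that its Fourier series
  converges. Hence the fundamental theorem of calculus is needed for derivatives that are merely
  integrable, and the derivatives are moved onto f before anything is expanded. The series in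
  \<open>h_kernel\<close> and \<open>R_kernel\<close> are integrals in Fourier form. The square
  function on one period has mean pi^2/3 and cosine coefficients 4 (-1)^j / j^2, so pairing it with
  K gives \<open>h_kernel\<close>; differentiating r times multiplies mode j by j^r, which gives
  \<open>R_kernel\<close>. (E1) is a fourth-moment condition because the Taylor remainder is small
  only near the base point; farther away it is dominated by a multiple of u^4. The exponents
  2/(2r+5) and 4/(2r+5) come from balancing h^2 against h^(-(2r+1)/2) / n.\<close>

definition circ :: "real measure" where
  "circ = restrict_space lborel {-pi..<pi}"

lemma space_circ [simp]: "space circ = {-pi..<pi}"
  by (simp add: circ_def space_restrict_space)

lemma measurable_circ [measurable (raw)]: "g \<in> borel_measurable borel \<Longrightarrow> g \<in> borel_measurable circ"
  unfolding circ_def by (rule measurable_restrict_space1) simp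

lemma measurable_ident_circ [measurable]: "(\<lambda>x. x) \<in> measurable circ borel"
  unfolding circ_def by (rule measurable_restrict_space1) simp

text \<open>Finiteness is the gain of a restricted measure over set integrals: square-integrable
  functions become integrable, bounded measurable functions become integrable, and the product
  \<open>circ\<close> with \<open>circ\<close> admits Fubini.\<close>

lemma finite_measure_circ: "finite_measure circ"
  by standard (simp add: circ_def emeasure_restrict_space space_restrict_space)

interpretation circ: finite_measure circ
  by (rule finite_measure_circ)

lemma measure_circ [simp]: "measure circ {-pi..<pi} = 2 * pi"
  by (simp add: circ_def measure_restrict_space)

lemma integral_circ: "integral\<^sup>L circ g = (LBINT x:{-pi..<pi}. g x)" for g :: "real \<Rightarrow> 'b::{banach, second_countable_topology}"
  unfolding circ_def set_lebesgue_integral_def by (rule integral_restrict_space) simp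

lemma integrable_circ: "integrable circ g \<longleftrightarrow> set_integrable lborel {-pi..<pi} g" for g :: "real \<Rightarrow> 'b::{banach, second_countable_topology}"
  unfolding circ_def set_integrable_def by (rule integrable_restrict_space) simp

lemma nn_integral_circ: "(\<integral>\<^sup>+x. g x \<partial>circ) = (\<integral>\<^sup>+x. g x * indicator {-pi..<pi} x \<partial>lborel)"
  unfolding circ_def by (rule nn_integral_restrict_space) simp

lemma integrable_circ_continuous:
  fixes g :: "real \<Rightarrow> real"
  assumes "continuous_on UNIV g"
  shows "integrable circ g"
proof -
  have "set_integrable lborel {-pi..pi} g"
    using assms by (intro borel_integrable_atLeastAtMost') (auto intro: continuous_on_subset)
  then have "set_integrable lborel {-pi..<pi} g"
    by (rule set_integrable_subset) auto
  then show ?thesis by (simp add: integrable_circ)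
qed

text \<open>The derivative \<open>g\<close> is integrable but possibly discontinuous. The gauge
  integral has the fundamental theorem for every derivative, and it agrees with the Lebesgue
  integral once the latter exists; dropping the endpoint pi changes a null set only.\<close>

lemma integral_circ_FTC:
  fixes g :: "real \<Rightarrow> real"
  assumes "\<And>x. (G has_field_derivative g x) (at x)" "integrable circ g"
  shows "integral\<^sup>L circ g = G pi - G (- pi)"
proof -
  have "(g has_integral (G pi - G (- pi))) {-pi..pi}"
    using assms(1)
    by (intro fundamental_theorem_of_calculus)
       (auto simp: has_real_derivative_iff_has_vector_derivative[symmetric] intro: has_field_derivative_at_within)
  then have "(g has_integral (G pi - G (- pi))) {-pi..<pi}"
    by (subst (asm) has_integral_spike_set_eq[where T = "{-pi..<pi}"])
       (auto intro: negligible_subset[of "{pi}"])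
  then show ?thesis
    using set_borel_integral_eq_integral(2)[of "{-pi..<pi}" g] assms(2)
    by (simp add: integral_circ integrable_circ integral_unique)
qed

section \<open>Invariance of the period integral under rotation and reflection\<close>

lemma periodic_of_int:
  fixes g :: "real \<Rightarrow> 'b"
  assumes "\<And>x. g (x + p) = g x"
  shows "g (x + p * of_int k) = g x"
proof (induction k rule: int_induct[where k = 0])
  case (step1 i)
  then show ?case using assms[of "x + p * of_int i"] by (simp add: algebra_simps)
next
  case (step2 i)
  then show ?case using assms[of "x + p * of_int (i - 1)"] by (simp add: algebra_simps)
qed simp

text \<open>A shift by s within one period moves the window to [-pi + s, pi + s); the part that
  sticks out beyond pi is moved back by one period and fills the gap on the left. Nonnegative
  integrals make the splitting free of integrability conditions.\<close>

lemma nn_integral_circ_rotate: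
  assumes [measurable]: "g \<in> borel_measurable borel" and per: "\<And>x. g (x + 2 * pi) = g x"
  shows "(\<integral>\<^sup>+x. g (x + t) \<partial>circ) = (\<integral>\<^sup>+x. g x \<partial>circ)"
proof -
  have shift: "(\<integral>\<^sup>+x. g (x + s) \<partial>circ) = (\<integral>\<^sup>+x. g x \<partial>circ)" if s: "0 \<le> s" "s \<le> 2 * pi" for s
  proof -
    have "(\<integral>\<^sup>+x. g (x + s) \<partial>circ) = (\<integral>\<^sup>+x. g x * indicator {-pi + s..<pi + s} x \<partial>lborel)"
      unfolding nn_integral_circ
      by (subst (2) nn_integral_real_affine[where c=1 and t=s])
         (auto simp: add.commute intro!: nn_integral_cong split: split_indicator)
    also have "\<dots> = (\<integral>\<^sup>+x. g x * indicator {-pi + s..<pi} x \<partial>lborel) + (\<integral>\<^sup>+x. g x * indicator {pi..<pi + s} x \<partial>lborel)"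
      using s by (subst nn_integral_add[symmetric]) (auto intro!: nn_integral_cong split: split_indicator)
    also have "(\<integral>\<^sup>+x. g x * indicator {pi..<pi + s} x \<partial>lborel) = (\<integral>\<^sup>+x. g x * indicator {-pi..<-pi + s} x \<partial>lborel)"
      by (subst nn_integral_real_affine[where c=1 and t="2 * pi"])
         (auto simp: per add.commute[of "2 * pi"] intro!: nn_integral_cong split: split_indicator)
    also have "(\<integral>\<^sup>+x. g x * indicator {-pi + s..<pi} x \<partial>lborel) + (\<integral>\<^sup>+x. g x * indicator {-pi..<-pi + s} x \<partial>lborel)
        = (\<integral>\<^sup>+x. g x \<partial>circ)"
      unfolding nn_integral_circ
      using s by (subst nn_integral_add[symmetric]) (auto intro!: nn_integral_cong split: split_indicator)
    finally show ?thesis .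
  qed
  have perk: "g (x + 2 * pi * of_int k) = g x" for x k
    using periodic_of_int[of g "2 * pi"] per by simp
  \<comment> \<open>Whole periods are removed from \<open>t\<close>, so that the remainder
    \<open>s\<close> lies within one period.\<close>
  define k where "k = \<lfloor>t / (2 * pi)\<rfloor>"
  define s where "s = t - 2 * pi * of_int k"
  have "0 \<le> s" "s \<le> 2 * pi"
    using floor_divide_lower[of "2 * pi" t] floor_divide_upper[of "2 * pi" t]
    by (auto simp: s_def k_def algebra_simps)
  moreover have "g (x + t) = g (x + s)" for x
    using perk[of "x + s" k] by (simp add: s_def algebra_simps)
  ultimately show ?thesis using shift by simp
qed

lemma nn_integral_circ_reflect:
  assumes [measurable]: "g \<in> borel_measurable borel"
  shows "(\<integral>\<^sup>+x. g (- x) \<partial>circ) = (\<integral>\<^sup>+x. g x \<partial>circ)"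
proof -
  have "(\<integral>\<^sup>+x. g (- x) \<partial>circ) = (\<integral>\<^sup>+x. g x * indicator {-pi<..pi} x \<partial>lborel)"
    unfolding nn_integral_circ
    by (subst (2) nn_integral_real_affine[where c="-1" and t=0])
       (auto intro!: nn_integral_cong split: split_indicator)
  also have "\<dots> = (\<integral>\<^sup>+x. g x \<partial>circ)"
    unfolding nn_integral_circ
    using AE_lborel_singleton[of "-pi"] AE_lborel_singleton[of pi]
    by (intro nn_integral_cong_AE) (auto split: split_indicator)
  finally show ?thesis .
qed

lemma nn_integral_circ_reflect_at:
  assumes "g \<in> borel_measurable borel" "\<And>x. g (x + 2 * pi) = g x"
  shows "(\<integral>\<^sup>+x. g (t - x) \<partial>circ) = (\<integral>\<^sup>+x. g x \<partial>circ)"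
proof -
  have [measurable]: "g \<in> borel_measurable borel" by fact
  have "(\<integral>\<^sup>+x. g (- x + t) \<partial>circ) = (\<integral>\<^sup>+x. g (x + t) \<partial>circ)"
    by (rule nn_integral_circ_reflect) measurable
  then show ?thesis
    using nn_integral_circ_rotate[OF assms, of t] by simp
qed

lemma
  fixes g :: "real \<Rightarrow> real"
  assumes [measurable]: "g \<in> borel_measurable borel" and per: "\<And>x. g (x + 2 * pi) = g x"
  shows integral_circ_reflect_at: "(\<integral>x. g (t - x) \<partial>circ) = integral\<^sup>L circ g"
    and integrable_circ_reflect_at: "integrable circ (\<lambda>x. g (t - x)) \<longleftrightarrow> integrable circ g"
proof -
  \<comment> \<open>\<open>ennreal\<close> sends negative values to 0. So the choices
    \<open>norm\<close>, identity and \<open>uminus\<close> for \<open>u\<close> give the absolute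
    value, the positive part and the negative part, and these determine integrability and the
    integral.\<close>
  have *: "(\<integral>\<^sup>+x. ennreal (u (g (t - x))) \<partial>circ) = (\<integral>\<^sup>+x. ennreal (u (g x)) \<partial>circ)"
    if [measurable]: "u \<in> borel_measurable borel" for u
    using nn_integral_circ_reflect_at[where g = "\<lambda>x. ennreal (u (g x))" and t = t]
    by (simp add: per)
  show I: "integrable circ (\<lambda>x. g (t - x)) \<longleftrightarrow> integrable circ g"
    using *[of norm] by (simp add: integrable_iff_bounded)
  show "(\<integral>x. g (t - x) \<partial>circ) = integral\<^sup>L circ g"
    using I *[of "\<lambda>x. x"] *[of uminus]
    by (cases "integrable circ g") (simp_all add: real_lebesgue_integral_def not_integrable_integral_eq)
qed

lemma integral_circ_reflect:
  fixes g :: "real \<Rightarrow> real"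
  assumes [measurable]: "g \<in> borel_measurable borel"
  shows "(\<integral>x. g (- x) \<partial>circ) = integral\<^sup>L circ g"
proof -
  have *: "(\<integral>\<^sup>+x. ennreal (u (g (- x))) \<partial>circ) = (\<integral>\<^sup>+x. ennreal (u (g x)) \<partial>circ)"
    if [measurable]: "u \<in> borel_measurable borel" for u
    by (rule nn_integral_circ_reflect) measurable
  have "integrable circ (\<lambda>x. g (- x)) \<longleftrightarrow> integrable circ g"
    using *[of norm] by (simp add: integrable_iff_bounded)
  then show ?thesis
    using *[of "\<lambda>x. x"] *[of uminus]
    by (cases "integrable circ g") (simp_all add: real_lebesgue_integral_def not_integrable_integral_eq)
qed

section \<open>Products with continuous factors and integration by parts\<close>

lemma integrable_circ_mult_continuous:
  fixes g :: "real \<Rightarrow> real"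
  assumes "continuous_on UNIV c" "integrable circ g"
  shows "integrable circ (\<lambda>x. c x * g x)"
proof -
  have "bounded (c ` {-pi..pi})"
    by (intro compact_imp_bounded compact_continuous_image continuous_on_subset[OF assms(1)]) auto
  then obtain B where B: "\<And>x. x \<in> {-pi..pi} \<Longrightarrow> \<bar>c x\<bar> \<le> B"
    unfolding bounded_iff by fastforce
  have [measurable]: "c \<in> borel_measurable borel" "g \<in> borel_measurable circ"
    using assms by (auto intro: borel_measurable_continuous_onI)
  show ?thesis
  proof (rule Bochner_Integration.integrable_bound)
    show "integrable circ (\<lambda>x. B * g x)" using assms(2) by simp
    show "AE x in circ. norm (c x * g x) \<le> norm (B * g x)"
      using B by (intro AE_I2) (force simp: abs_mult intro!: mult_right_mono)
  qed simp
qed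

text \<open>The hypotheses are asymmetric on purpose: \<open>u'\<close> will be the top derivative
  of a kernel, which is only integrable, while \<open>v'\<close> is continuous. Periodicity of both
  factors removes the boundary terms.\<close>

lemma integral_circ_by_parts:
  fixes u v :: "real \<Rightarrow> real"
  assumes u: "\<And>x. (u has_field_derivative u' x) (at x)" "integrable circ u'" "u pi = u (- pi)"
    and v: "\<And>x. (v has_field_derivative v' x) (at x)" "continuous_on UNIV v'" "v pi = v (- pi)"
  shows "(\<integral>x. u' x * v x \<partial>circ) = - (\<integral>x. u x * v' x \<partial>circ)"
proof -
  have "continuous_on UNIV u" "continuous_on UNIV v"
    using u(1) v(1) by (auto intro!: DERIV_isCont continuous_at_imp_continuous_on)
  then have I: "integrable circ (\<lambda>x. v x * u' x)" "integrable circ (\<lambda>x. u x * v' x)"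
    using integrable_circ_mult_continuous[OF _ u(2), of v] v(2)
    by (auto intro!: integrable_circ_continuous continuous_on_mult)
  have "(\<integral>x. v x * u' x + u x * v' x \<partial>circ) = u pi * v pi - u (- pi) * v (- pi)"
  proof (rule integral_circ_FTC[where G = "\<lambda>x. u x * v x"])
    show "((\<lambda>x. u x * v x) has_field_derivative v x * u' x + u x * v' x) (at x)" for x
      using DERIV_mult[OF u(1) v(1), of x] by (simp add: algebra_simps)
  qed (use I in simp)
  then show ?thesis
    using I u(3) v(3) by (simp add: mult.commute[of "v _"])
qed

text \<open>Families \<open>u i\<close> and \<open>v i\<close> take the place of iterated
  \<open>deriv\<close>, so that \<open>v\<close> may be a cosine with advancing phase or a
  reflected, signed derivative of f. Only the top member \<open>u r\<close> is merely integrable;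
  the lower ones are differentiable, hence continuous.\<close>

lemma integral_circ_by_parts_iterated:
  fixes u v :: "nat \<Rightarrow> real \<Rightarrow> real"
  assumes u: "\<And>i x. i < r \<Longrightarrow> (u i has_field_derivative u (Suc i) x) (at x)"
      "integrable circ (u r)" "\<And>i. i < r \<Longrightarrow> u i pi = u i (- pi)"
    and v: "\<And>i x. i < r \<Longrightarrow> (v i has_field_derivative v (Suc i) x) (at x)"
      "continuous_on UNIV (v r)" "\<And>i. i < r \<Longrightarrow> v i pi = v i (- pi)"
  shows "(\<integral>x. u r x * v 0 x \<partial>circ) = (-1) ^ r * (\<integral>x. u 0 x * v r x \<partial>circ)"
proof -
  have cont: "continuous_on UNIV (u i)" "continuous_on UNIV (v i)" if "i < r" for i
    using that u(1) v(1) by (auto intro!: DERIV_isCont continuous_at_imp_continuous_on)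
  have "k \<le> r \<Longrightarrow> (\<integral>x. u r x * v 0 x \<partial>circ) = (-1) ^ k * (\<integral>x. u (r - k) x * v k x \<partial>circ)" for k
  proof (induction k)
    case (Suc k)
    have *: "Suc (r - Suc k) = r - k" using Suc.prems by simp
    have "integrable circ (u (r - k))"
      using u(2) cont(1)[of "r - k"] Suc.prems by (cases "k = 0") (auto intro!: integrable_circ_continuous)
    moreover have "continuous_on UNIV (v (Suc k))"
      using Suc.prems v(2) cont(2) by (cases "Suc k = r") auto
    ultimately have "(\<integral>x. u (r - k) x * v k x \<partial>circ) = - (\<integral>x. u (r - Suc k) x * v (Suc k) x \<partial>circ)"
      using Suc.prems u(1)[of "r - Suc k"] v(1)[of k] u(3)[of "r - Suc k"] v(3)[of k]
      by (intro integral_circ_by_parts) (auto simp: *)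
    then show ?case using Suc by simp
  qed simp
  from this[of r] show ?thesis by simp
qed

lemma integral_circ_const [simp]: "(\<integral>x. c \<partial>circ) = 2 * pi * (c :: real)"
  by simp

text \<open>The frequency is an integer because the product-to-sum formula produces the difference
  of two frequencies, which can be zero or negative.\<close>

lemma integral_circ_cos:
  "(\<integral>x. cos (of_int m * x + c) \<partial>circ) = (if m = 0 then 2 * pi * cos c else 0)"
proof (cases "m = 0")
  case False
  have "(\<integral>x. cos (of_int m * x + c) \<partial>circ)
      = sin (of_int m * pi + c) / of_int m - sin (of_int m * (- pi) + c) / of_int m"
  proof (rule integral_circ_FTC[where G = "\<lambda>x. sin (of_int m * x + c) / of_int m"])
    show "((\<lambda>x. sin (of_int m * x + c) / of_int m) has_field_derivative cos (of_int m * x + c)) (at x)" for x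
      using False by (auto intro!: derivative_eq_intros)
    show "integrable circ (\<lambda>x. cos (of_int m * x + c))"
      by (intro integrable_circ_continuous continuous_intros)
  qed
  also have "\<dots> = 0"
    by (simp add: sin_add sin_diff mult.commute)
  finally show ?thesis using False by simp
qed simp

subsection \<open>Cosine series\<close>

text \<open>The free phase closes the family under the operations needed: a derivative adds pi/2 to
  the phase, and a difference quotient adds pi/2 and half the shift of the argument. The frequency
  \<open>Suc j\<close> leaves the constant mode out, so constants are carried separately.\<close>

definition phase_cos :: "(nat \<Rightarrow> real) \<Rightarrow> nat \<Rightarrow> real \<Rightarrow> real" where
  "phase_cos b j x = cos (real (Suc j) * x + b j)"

lemma continuous_phase_cos [continuous_intros]: "continuous_on S (phase_cos b j)"
  unfolding phase_cos_def by (intro continuous_intros)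

lemma phase_cos_measurable [measurable]: "phase_cos b j \<in> borel_measurable borel"
  by (intro borel_measurable_continuous_onI continuous_phase_cos)

lemma integrable_phase_cos [simp]: "integrable circ (phase_cos b j)"
  by (intro integrable_circ_continuous continuous_intros)

lemma abs_phase_cos_le: "\<bar>phase_cos b j x\<bar> \<le> 1"
  by (simp add: phase_cos_def)

lemma integral_phase_cos: "integral\<^sup>L circ (phase_cos b j) = 0"
  using integral_circ_cos[of "int (Suc j)" "b j"] by (simp add: phase_cos_def[abs_def])

lemma integrable_mult_phase_cos: "integrable circ g \<Longrightarrow> integrable circ (\<lambda>x. g x * phase_cos b j x)"
  using integrable_circ_mult_continuous[OF continuous_phase_cos, of g b j] by (simp add: mult.commute)

lemma integral_phase_cos_mult:
  "(\<integral>x. phase_cos b j x * phase_cos b k x \<partial>circ) = (if j = k then pi else 0)"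
proof -
  have "(\<integral>x. phase_cos b j x * phase_cos b k x \<partial>circ) =
      (\<integral>x. (cos (of_int (int j - int k) * x + (b j - b k))
           + cos (of_int (int j + int k + 2) * x + (b j + b k))) / 2 \<partial>circ)"
    by (intro Bochner_Integration.integral_cong refl)
       (simp add: phase_cos_def cos_times_cos algebra_simps)
  also have "\<dots> = ((\<integral>x. cos (of_int (int j - int k) * x + (b j - b k)) \<partial>circ)
           + (\<integral>x. cos (of_int (int j + int k + 2) * x + (b j + b k)) \<partial>circ)) / 2"
    by (subst integral_divide_zero, subst Bochner_Integration.integral_add)
       (auto intro!: integrable_circ_continuous continuous_intros)
  also have "\<dots> = (if j = k then pi else 0)"
    unfolding integral_circ_cos by auto
  finally show ?thesis .
qed

text \<open>One exchange of sum and integral, for an arbitrary integrable weight \<open>w\<close>.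
  The weight 1 gives the mean, \<open>phase_cos\<close> the coefficients, the series itself
  Parseval's identity, and the square function the second moment of a kernel.\<close>

lemma
  assumes a: "summable (\<lambda>j. \<bar>a j\<bar>)" and w: "integrable circ w"
  shows integral_mult_cos_series_sums:
      "(\<lambda>j. a j * (\<integral>x. w x * phase_cos b j x \<partial>circ)) sums (\<integral>x. w x * (\<Sum>j. a j * phase_cos b j x) \<partial>circ)"
    and integrable_mult_cos_series: "integrable circ (\<lambda>x. w x * (\<Sum>j. a j * phase_cos b j x))"
proof -
  have [measurable]: "w \<in> borel_measurable circ" using w by auto
  have bd: "\<bar>a j * phase_cos b j x\<bar> \<le> \<bar>a j\<bar>" for j x
    using mult_left_mono[OF abs_phase_cos_le, of "\<bar>a j\<bar>"] by (simp add: abs_mult)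
  have sm: "summable (\<lambda>j. a j * phase_cos b j x)" for x
    using bd by (intro summable_comparison_test'[OF a]) auto
  have int: "integrable circ (\<lambda>x. w x * (a j * phase_cos b j x))" for j
    using integrable_mult_phase_cos[OF w, of b j]
    by (subst mult.left_commute) simp
  have sn: "summable (\<lambda>j. norm (w x * (a j * phase_cos b j x)))" for x
    unfolding norm_mult using bd
    by (intro summable_mult summable_comparison_test'[OF a]) (auto simp: abs_mult)
  have si: "summable (\<lambda>j. \<integral>x. norm (w x * (a j * phase_cos b j x)) \<partial>circ)"
  proof (rule summable_comparison_test')
    show "summable (\<lambda>j. \<bar>a j\<bar> * (\<integral>x. \<bar>w x\<bar> \<partial>circ))" by (intro summable_mult2 a)
    fix j
    have "(\<integral>x. norm (w x * (a j * phase_cos b j x)) \<partial>circ) \<le> (\<integral>x. \<bar>a j\<bar> * \<bar>w x\<bar> \<partial>circ)"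
    proof (rule integral_mono)
      show "integrable circ (\<lambda>x. norm (w x * (a j * phase_cos b j x)))" using int by (rule integrable_norm)
      show "integrable circ (\<lambda>x. \<bar>a j\<bar> * \<bar>w x\<bar>)" using w by auto
      show "norm (w x * (a j * phase_cos b j x)) \<le> \<bar>a j\<bar> * \<bar>w x\<bar>" for x
        using mult_left_mono[OF bd[of j x], of "\<bar>w x\<bar>"] by (simp add: abs_mult mult_ac)
    qed
    then show "norm (\<integral>x. norm (w x * (a j * phase_cos b j x)) \<partial>circ) \<le> \<bar>a j\<bar> * (\<integral>x. \<bar>w x\<bar> \<partial>circ)"
      by simp
  qed
  have eq: "w x * (\<Sum>j. a j * phase_cos b j x) = (\<Sum>j. w x * (a j * phase_cos b j x))" for x
    using sm by (simp add: suminf_mult)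
  show "(\<lambda>j. a j * (\<integral>x. w x * phase_cos b j x \<partial>circ)) sums (\<integral>x. w x * (\<Sum>j. a j * phase_cos b j x) \<partial>circ)"
    using sums_integral[of circ "\<lambda>j x. w x * (a j * phase_cos b j x)"] int sn si
    by (simp add: eq mult.left_commute[of "w _"])
  show "integrable circ (\<lambda>x. w x * (\<Sum>j. a j * phase_cos b j x))"
    unfolding eq using int sn si by (intro integrable_suminf) auto
qed

lemma
  fixes a b :: "nat \<Rightarrow> real" and c :: real
  assumes a: "summable (\<lambda>j. \<bar>a j\<bar>)"
  defines "G \<equiv> \<lambda>x. c + (\<Sum>j. a j * phase_cos b j x)"
  shows integrable_cos_series: "integrable circ G"
    and integral_cos_series: "integral\<^sup>L circ G = 2 * pi * c"
    and cos_series_coeff: "(\<integral>x. G x * phase_cos b k x \<partial>circ) = pi * a k"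
proof -
  let ?S = "\<lambda>x. \<Sum>j. a j * phase_cos b j x"
  have intS: "integrable circ ?S"
    using integrable_mult_cos_series[OF a, of "\<lambda>_. 1" b] by (simp add: integrable_circ_continuous)
  show "integrable circ G"
    unfolding G_def using intS by (intro Bochner_Integration.integrable_add) auto
  have "integral\<^sup>L circ ?S = 0"
    using integral_mult_cos_series_sums[OF a, of "\<lambda>_. 1" b]
    by (simp add: integral_phase_cos integrable_circ_continuous sums_unique2)
  then show "integral\<^sup>L circ G = 2 * pi * c"
    unfolding G_def using intS by (subst Bochner_Integration.integral_add) auto
  have "(\<lambda>j. a j * (if k = j then pi else 0)) sums (\<integral>x. phase_cos b k x * ?S x \<partial>circ)"
    using integral_mult_cos_series_sums[OF a integrable_phase_cos, of b k b] by (simp add: integral_phase_cos_mult)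
  moreover have "(\<lambda>j. a j * (if k = j then pi else 0)) sums (a k * pi)"
    using sums_single[of k "\<lambda>j. a j * pi"] by (simp add: if_distrib eq_commute cong: if_cong)
  ultimately have "(\<integral>x. phase_cos b k x * ?S x \<partial>circ) = a k * pi" by (rule sums_unique2)
  moreover have "(\<integral>x. G x * phase_cos b k x \<partial>circ) = (\<integral>x. c * phase_cos b k x + phase_cos b k x * ?S x \<partial>circ)"
    by (simp add: G_def algebra_simps)
  ultimately show "(\<integral>x. G x * phase_cos b k x \<partial>circ) = pi * a k"
    using integrable_mult_cos_series[OF a, of "phase_cos b k" b] by (simp add: integral_phase_cos)
qed

text \<open>For absolutely summable coefficients Parseval's identity is termwise integration with
  the weight \<open>G\<close> itself: the square of \<open>G\<close> is \<open>c * G\<close> plus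
  \<open>G\<close> times its series, and the coefficients of \<open>G\<close> are already
  known.\<close>

lemma parseval_cos_series:
  fixes a b :: "nat \<Rightarrow> real" and c :: real
  assumes a: "summable (\<lambda>j. \<bar>a j\<bar>)"
  defines "G \<equiv> \<lambda>x. c + (\<Sum>j. a j * phase_cos b j x)"
  shows "(\<lambda>j. pi * (a j)\<^sup>2) sums ((\<integral>x. (G x)\<^sup>2 \<partial>circ) - 2 * pi * c\<^sup>2)"
    and "integrable circ (\<lambda>x. (G x)\<^sup>2)"
proof -
  let ?S = "\<lambda>x. \<Sum>j. a j * phase_cos b j x"
  have [simp]: "integrable circ G" "integral\<^sup>L circ G = 2 * pi * c"
      "(\<integral>x. G x * phase_cos b k x \<partial>circ) = pi * a k" for k
    unfolding G_def by (rule integrable_cos_series[OF a] integral_cos_series[OF a] cos_series_coeff[OF a])+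
  have sq: "(G x)\<^sup>2 = c * G x + G x * ?S x" for x
    by (simp add: G_def power2_eq_square algebra_simps)
  have iGS: "integrable circ (\<lambda>x. G x * ?S x)" by (rule integrable_mult_cos_series[OF a]) simp
  show "integrable circ (\<lambda>x. (G x)\<^sup>2)" unfolding sq using iGS by auto
  have "(\<integral>x. (G x)\<^sup>2 \<partial>circ) - 2 * pi * c\<^sup>2 = (\<integral>x. G x * ?S x \<partial>circ)"
    unfolding sq using iGS by (simp add: power2_eq_square)
  then show "(\<lambda>j. pi * (a j)\<^sup>2) sums ((\<integral>x. (G x)\<^sup>2 \<partial>circ) - 2 * pi * c\<^sup>2)"
    using integral_mult_cos_series_sums[OF a, of G b] by (simp add: power2_eq_square mult_ac)
qed

lemma bessel_phase_cos:
  assumes g[measurable]: "g \<in> borel_measurable borel" and sq: "integrable circ (\<lambda>x. (g x)\<^sup>2)"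
  shows "(\<Sum>j<N. (\<integral>x. g x * phase_cos b j x \<partial>circ)\<^sup>2) \<le> pi * (\<integral>x. (g x)\<^sup>2 \<partial>circ)"
proof -
  have g1: "integrable circ g"
    by (rule circ.square_integrable_imp_integrable[OF _ sq]) simp
  define c where "c j = (\<integral>x. g x * phase_cos b j x \<partial>circ)" for j
  \<comment> \<open>\<open>S\<close> is the orthogonal projection of \<open>g\<close> on the first N
    modes; the division by pi reflects that each mode has squared norm pi.\<close>
  define S where "S x = (\<Sum>j<N. c j / pi * phase_cos b j x)" for x
  have contS: "continuous_on UNIV S" unfolding S_def[abs_def] by (intro continuous_intros)
  have gS: "integrable circ (\<lambda>x. g x * S x)"
    using integrable_circ_mult_continuous[OF contS g1] by (simp add: mult.commute)
  have SS: "integrable circ (\<lambda>x. S x * S x)"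
    using contS by (intro integrable_circ_continuous continuous_intros)
  have e1: "(\<integral>x. g x * S x \<partial>circ) = (\<Sum>j<N. (c j)\<^sup>2) / pi"
  proof -
    have "(\<integral>x. g x * S x \<partial>circ) = (\<integral>x. (\<Sum>j<N. c j / pi * (g x * phase_cos b j x)) \<partial>circ)"
      by (simp add: S_def sum_distrib_left mult_ac)
    also have "\<dots> = (\<Sum>j<N. c j / pi * c j)"
      using integrable_mult_phase_cos[OF g1] by (subst Bochner_Integration.integral_sum) (auto simp: c_def)
    finally show ?thesis by (simp add: sum_divide_distrib power2_eq_square)
  qed
  have e2: "(\<integral>x. S x * S x \<partial>circ) = (\<Sum>j<N. (c j)\<^sup>2) / pi"
  proof -
    have ii: "integrable circ (\<lambda>x. phase_cos b j x * phase_cos b k x)" for j k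
      by (intro integrable_mult_phase_cos) simp
    have "(\<integral>x. S x * S x \<partial>circ) = (\<integral>x. (\<Sum>j<N. \<Sum>k<N. c j / pi * (c k / pi) * (phase_cos b j x * phase_cos b k x)) \<partial>circ)"
      by (simp add: S_def sum_product mult_ac)
    also have "\<dots> = (\<Sum>j<N. \<Sum>k<N. c j / pi * (c k / pi) * (if j = k then pi else 0))"
      using ii by (subst Bochner_Integration.integral_sum, force)
        (subst Bochner_Integration.integral_sum, auto simp: integral_phase_cos_mult)
    also have "\<dots> = (\<Sum>j<N. (c j)\<^sup>2 / pi)"
      by (intro sum.cong refl) (simp add: if_distrib[of "\<lambda>y. _ * y"] power2_eq_square cong: if_cong)
    finally show ?thesis by (simp add: sum_divide_distrib)
  qed
  have "0 \<le> (\<integral>x. (g x - S x)\<^sup>2 \<partial>circ)" by simp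
  also have "\<dots> = (\<integral>x. (g x)\<^sup>2 - 2 * (g x * S x) + S x * S x \<partial>circ)"
    by (intro Bochner_Integration.integral_cong) (auto simp: power2_eq_square algebra_simps)
  also have "\<dots> = (\<integral>x. (g x)\<^sup>2 \<partial>circ) - (\<Sum>j<N. (c j)\<^sup>2) / pi"
    using sq gS SS e1 e2 by simp
  finally show ?thesis by (simp add: c_def field_simps)
qed

section \<open>Termwise differentiation and Parseval's identity for derivatives\<close>

lemma nth_deriv_has_derivative:
  "times_differentiable r g \<Longrightarrow> k < r \<Longrightarrow> (nth_deriv k g has_field_derivative nth_deriv (Suc k) g x) (at x)"
  by (simp add: times_differentiable_def DERIV_deriv_iff_field_differentiable)

text \<open>\<open>deriv\<close> is a choice over the derivative predicate, and this predicate is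
  the same at x and at x + p. So the chosen values agree even at points where no derivative
  exists.\<close>

lemma nth_deriv_periodic:
  fixes g :: "real \<Rightarrow> real"
  assumes "\<And>x. g (x + p) = g x"
  shows "nth_deriv k g (x + p) = nth_deriv k g x"
proof (induction k arbitrary: x)
  case (Suc k)
  have "(\<lambda>x. nth_deriv k g (x + p)) = nth_deriv k g" using Suc.IH by auto
  then have "(nth_deriv k g has_field_derivative D) (at (x + p)) \<longleftrightarrow> (nth_deriv k g has_field_derivative D) (at x)" for D
    using DERIV_shift[of "nth_deriv k g" D x p] by simp
  then show ?case by (simp add: deriv_def[of "nth_deriv k g"])
qed (simp add: assms)

lemma cos_series_has_derivative:
  fixes a b :: "nat \<Rightarrow> real"
  assumes a: "summable (\<lambda>j. \<bar>real (Suc j) * a j\<bar>)"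
  shows "((\<lambda>x. c + (\<Sum>j. a j * phase_cos b j x)) has_field_derivative
           (\<Sum>j. real (Suc j) * a j * phase_cos (\<lambda>j. b j + pi / 2) j x)) (at x)"
proof -
  have a': "summable (\<lambda>j. \<bar>a j\<bar>)"
    by (rule summable_comparison_test'[OF a]) (auto simp: abs_mult mult_le_cancel_right1)
  have bd: "\<bar>d * phase_cos b j x\<bar> \<le> \<bar>d\<bar>" for d b j x
    using mult_left_mono[OF abs_phase_cos_le, of "\<bar>d\<bar>"] by (simp add: abs_mult)
  have "((\<lambda>x. \<Sum>j. a j * phase_cos b j x) has_field_derivative
           (\<Sum>j. real (Suc j) * a j * phase_cos (\<lambda>j. b j + pi / 2) j x)) (at x)"
  proof (rule has_field_derivative_series'(2)[where S = UNIV and ?x0.0 = 0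
        and f = "\<lambda>j x. a j * phase_cos b j x"
        and f' = "\<lambda>j x. real (Suc j) * a j * phase_cos (\<lambda>j. b j + pi / 2) j x"])
    show "((\<lambda>x. a j * phase_cos b j x) has_field_derivative
        real (Suc j) * a j * phase_cos (\<lambda>j. b j + pi / 2) j x) (at x within UNIV)" for j x
      unfolding phase_cos_def by (auto intro!: derivative_eq_intros simp: cos_add sin_add algebra_simps)
    show "uniformly_convergent_on UNIV (\<lambda>n x. \<Sum>j<n. real (Suc j) * a j * phase_cos (\<lambda>j. b j + pi / 2) j x)"
      using bd by (intro Weierstrass_m_test'[OF _ a]) auto
    show "summable (\<lambda>j. a j * phase_cos b j 0)"
      using bd by (intro summable_comparison_test'[OF a']) auto
  qed auto
  then show ?thesis by (auto intro!: derivative_eq_intros)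
qed

text \<open>The constant is existential because it is the given one for k = 0 and becomes 0 after
  the first differentiation. Later uses only need some constant.\<close>

lemma nth_deriv_cos_series:
  fixes a b :: "nat \<Rightarrow> real"
  assumes "\<And>x. G x = c + (\<Sum>j. a j * phase_cos b j x)"
    and "summable (\<lambda>j. \<bar>real (Suc j) ^ k * a j\<bar>)"
  shows "\<exists>c. \<forall>x. nth_deriv k G x = c + (\<Sum>j. real (Suc j) ^ k * a j * phase_cos (\<lambda>j. b j + real k * pi / 2) j x)"
  using assms(2)
proof (induction k)
  case 0
  then show ?case using assms(1) by auto
next
  case (Suc k)
  have "summable (\<lambda>j. \<bar>real (Suc j) ^ k * a j\<bar>)"
    by (rule summable_comparison_test'[OF Suc.prems])
       (auto simp: abs_mult mult_le_cancel_right1)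
  from Suc.IH[OF this] obtain c where c:
    "nth_deriv k G = (\<lambda>x. c + (\<Sum>j. real (Suc j) ^ k * a j * phase_cos (\<lambda>j. b j + real k * pi / 2) j x))" by auto
  have "nth_deriv (Suc k) G x = (\<Sum>j. real (Suc j) ^ Suc k * a j * phase_cos (\<lambda>j. b j + real (Suc k) * pi / 2) j x)" for x
  proof -
    have "nth_deriv (Suc k) G x = deriv (\<lambda>x. c + (\<Sum>j. real (Suc j) ^ k * a j * phase_cos (\<lambda>j. b j + real k * pi / 2) j x)) x"
      by (simp add: c)
    also have "\<dots> = (\<Sum>j. real (Suc j) * (real (Suc j) ^ k * a j) * phase_cos (\<lambda>j. b j + real k * pi / 2 + pi / 2) j x)"
      using Suc.prems by (intro DERIV_imp_deriv cos_series_has_derivative) (simp add: mult_ac)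
    finally show ?thesis by (simp add: algebra_simps add_divide_distrib)
  qed
  then show ?case by (intro exI[of _ 0]) auto
qed

text \<open>Only the squares of the differentiated coefficients are summable, so the series for
  \<open>G\<close> cannot be differentiated term by term. Each difference quotient of
  \<open>G\<close>, however, is again an absolutely convergent cosine series, so Parseval's identity
  applies to it, with a bound that does not depend on the step.\<close>

lemma nn_integral_deriv_cos_series_le:
  fixes a b :: "nat \<Rightarrow> real"
  assumes G: "\<And>x. G x = c + (\<Sum>j. a j * phase_cos b j x)" and a: "summable (\<lambda>j. \<bar>a j\<bar>)"
    and deriv: "\<And>x. (G has_field_derivative g x) (at x)" and [measurable]: "g \<in> borel_measurable borel"
    and sm: "summable (\<lambda>j. (real (Suc j) * a j)\<^sup>2)"
  shows "(\<integral>\<^sup>+x. ennreal ((g x)\<^sup>2) \<partial>circ) \<le> ennreal (pi * (\<Sum>j. (real (Suc j) * a j)\<^sup>2))"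
proof -
  define D where "D m x = (G (x + inverse (real (Suc m))) - G x) / inverse (real (Suc m))" for m x
  have "continuous_on UNIV G"
    using deriv by (auto intro!: DERIV_isCont continuous_at_imp_continuous_on)
  then have [measurable]: "G \<in> borel_measurable borel" by (rule borel_measurable_continuous_onI)
  have [measurable]: "D m \<in> borel_measurable borel" for m unfolding D_def[abs_def] by measurable
  have lim: "(\<lambda>m. D m x) \<longlonglongrightarrow> g x" for x
  proof -
    have "((\<lambda>h. (G (x + h) - G x) / h) \<longlongrightarrow> g x) (at 0)" using deriv by (simp add: DERIV_def)
    moreover have "filterlim (\<lambda>m. inverse (real (Suc m))) (at 0) sequentially"
      using LIMSEQ_inverse_real_of_nat by (auto simp: filterlim_at)
    ultimately show ?thesis unfolding D_def by (rule filterlim_compose)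
  qed
  have bd: "(\<integral>\<^sup>+x. ennreal ((D m x)\<^sup>2) \<partial>circ) \<le> ennreal (pi * (\<Sum>j. (real (Suc j) * a j)\<^sup>2))" for m
  proof -
    define t where "t = inverse (real (Suc m))"
    have t: "0 < t" by (simp add: t_def)
    \<comment> \<open>From cos(y + s) - cos y = 2 sin(s/2) cos(y + s/2 + pi/2): division by the step
      \<open>t\<close> gives the new coefficient \<open>d j\<close>, and the midpoint together with
      the quarter turn gives the new phase.\<close>
    define d where "d j = a j * (2 * sin (real (Suc j) * t / 2) / t)" for j
    define \<beta> where "\<beta> j = b j + real (Suc j) * t / 2 + pi / 2" for j
    have summ: "summable (\<lambda>j. a j * phase_cos b j x)" for x
      using mult_left_mono[OF abs_phase_cos_le, of "\<bar>a _\<bar>"]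
      by (intro summable_comparison_test'[OF a]) (auto simp: abs_mult)
    have D: "D m x = 0 + (\<Sum>j. d j * phase_cos \<beta> j x)" for x
    proof -
      have "D m x = (\<Sum>j. a j * phase_cos b j (x + t) - a j * phase_cos b j x) / t"
        using suminf_diff[OF summ[of "x + t"] summ[of x]] by (simp add: D_def G t_def)
      also have "\<dots> = (\<Sum>j. (a j * phase_cos b j (x + t) - a j * phase_cos b j x) / t)"
        by (intro suminf_divide[symmetric] summable_diff summ)
      also have "\<dots> = (\<Sum>j. d j * phase_cos \<beta> j x)"
      proof (intro arg_cong[where f = suminf] ext)
        fix j
        define y where "y = real (Suc j) * x + b j"
        define s where "s = real (Suc j) * t"
        have "cos (y + s) - cos y = 2 * sin (s / 2) * cos (y + s / 2 + pi / 2)"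
          by (subst cos_diff_cos) (simp add: cos_add sin_add add_divide_distrib algebra_simps)
        moreover have "phase_cos b j (x + t) = cos (y + s)" "phase_cos b j x = cos y"
          "phase_cos \<beta> j x = cos (y + s / 2 + pi / 2)"
          by (simp_all add: phase_cos_def y_def s_def \<beta>_def algebra_simps)
        ultimately show "(a j * phase_cos b j (x + t) - a j * phase_cos b j x) / t = d j * phase_cos \<beta> j x"
          by (simp add: d_def s_def flip: right_diff_distrib)
      qed
      finally show ?thesis by simp
    qed
    \<comment> \<open>For a fixed step the crude factor 2/t suffices. It blows up as t tends to 0,
      so it serves for summability only.\<close>
    have dsum: "summable (\<lambda>j. \<bar>d j\<bar>)"
    proof (rule summable_comparison_test')
      show "summable (\<lambda>j. \<bar>a j\<bar> * (2 / t))" by (intro summable_mult2 a)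
      show "norm \<bar>d j\<bar> \<le> \<bar>a j\<bar> * (2 / t)" for j
        using t by (auto simp: d_def abs_mult intro!: mult_left_mono divide_right_mono)
    qed
    \<comment> \<open>The bound that is uniform in the step: |sin y| is at most |y|, so the
      multiplier never exceeds the frequency.\<close>
    have dle: "(d j)\<^sup>2 \<le> (real (Suc j) * a j)\<^sup>2" for j
    proof -
      have "\<bar>sin (real (Suc j) * t / 2)\<bar> \<le> real (Suc j) * t / 2"
        using abs_sin_x_le_abs_x[of "real (Suc j) * t / 2"] t by simp
      then have "\<bar>2 * sin (real (Suc j) * t / 2) / t\<bar> \<le> real (Suc j)"
        using t by (simp add: abs_mult field_simps)
      from mult_right_mono[OF this, of "\<bar>a j\<bar>"] have "\<bar>d j\<bar> \<le> \<bar>real (Suc j) * a j\<bar>"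
        by (simp add: d_def abs_mult mult_ac)
      then show ?thesis by (simp only: abs_le_square_iff)
    qed
    have P: "(\<lambda>j. pi * (d j)\<^sup>2) sums (\<integral>x. (D m x)\<^sup>2 \<partial>circ)" "integrable circ (\<lambda>x. (D m x)\<^sup>2)"
      using parseval_cos_series[OF dsum, of 0 \<beta>] by (simp_all add: D)
    have "(\<integral>x. (D m x)\<^sup>2 \<partial>circ) \<le> (\<Sum>j. pi * (real (Suc j) * a j)\<^sup>2)"
      using dle by (subst sums_unique[OF P(1)], intro suminf_le sums_summable[OF P(1)] summable_mult sm) auto
    also have "\<dots> = pi * (\<Sum>j. (real (Suc j) * a j)\<^sup>2)"
      by (intro suminf_mult sm)
    finally show ?thesis
      by (subst nn_integral_eq_integral[OF P(2)]) (auto intro: ennreal_leI)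
  qed
  have "(\<integral>\<^sup>+x. ennreal ((g x)\<^sup>2) \<partial>circ) = (\<integral>\<^sup>+x. liminf (\<lambda>m. ennreal ((D m x)\<^sup>2)) \<partial>circ)"
    using lim by (intro nn_integral_cong lim_imp_Liminf[symmetric] tendsto_ennrealI tendsto_power) auto
  also have "\<dots> \<le> liminf (\<lambda>m. \<integral>\<^sup>+x. ennreal ((D m x)\<^sup>2) \<partial>circ)"
    by (intro nn_integral_liminf) measurable
  also have "\<dots> \<le> ennreal (pi * (\<Sum>j. (real (Suc j) * a j)\<^sup>2))"
    using bd by (intro order_trans[OF Liminf_le_Limsup Limsup_bounded]) auto
  finally show ?thesis .
qed

lemma cos_periodic_npi: "cos (real n * pi + c) = cos (real n * (- pi) + c)"
  by (simp add: cos_add cos_diff mult.commute)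

text \<open>For r > 0 the constant \<open>c\<close> is differentiated away, so no term for it
  appears. The case r = 0, where it survives, is \<open>parseval_cos_series\<close>.\<close>

theorem parseval_nth_deriv_cos_series:
  fixes a :: "nat \<Rightarrow> real"
  assumes G: "\<And>x. G x = c + (\<Sum>j. a j * phase_cos (\<lambda>_. 0) j x)" and a: "summable (\<lambda>j. \<bar>a j\<bar>)"
    and diff: "times_differentiable r G" and r: "0 < r" and sq: "circular_square_integrable (nth_deriv r G)"
  shows "(\<lambda>j. pi * (real (Suc j) ^ r * a j)\<^sup>2) sums (\<integral>x. (nth_deriv r G x)\<^sup>2 \<partial>circ)"
proof -
  let ?g = "nth_deriv r G"
  have gm [measurable]: "?g \<in> borel_measurable borel" and sq: "integrable circ (\<lambda>x. (?g x)\<^sup>2)"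
    using sq by (auto simp: circular_square_integrable_def integrable_circ)
  have g1: "integrable circ ?g"
    by (rule circ.square_integrable_imp_integrable[OF _ sq]) simp
  have per: "G (x + 2 * pi) = G x" for x
  proof -
    have "phase_cos (\<lambda>_. 0) j (x + 2 * pi) = phase_cos (\<lambda>_. 0) j x" for j
      using cos_add[of "real (Suc j) * x" "2 * real (Suc j) * pi"] sin_2npi[of "Suc j"] cos_2npi[of "Suc j"]
      by (simp add: phase_cos_def algebra_simps)
    then show ?thesis by (simp add: G)
  qed
  \<comment> \<open>The r-th derivative turns each phase by r * pi / 2, so it is tested against that
    phase. Moving the r derivatives onto the cosine adds another r * pi / 2; the total phase r * pi
    contributes (-1)^r and cancels the sign from the integrations by parts.\<close>
  have coeff: "(\<integral>x. ?g x * phase_cos (\<lambda>_. real r * pi / 2) j x \<partial>circ) = pi * (real (Suc j) ^ r * a j)" for j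
  proof -
    define v where "v i x = real (Suc j) ^ i * cos (real (Suc j) * x + (real r * pi / 2 + real i * pi / 2))" for i x
    have v0: "v 0 x = phase_cos (\<lambda>_. real r * pi / 2) j x" for x by (simp add: v_def phase_cos_def)
    have vr: "v r x = (-1) ^ r * (real (Suc j) ^ r * phase_cos (\<lambda>_. 0) j x)" for x
      by (simp add: v_def phase_cos_def cos_add)
    have "(\<integral>x. ?g x * v 0 x \<partial>circ) = (-1) ^ r * (\<integral>x. nth_deriv 0 G x * v r x \<partial>circ)"
    proof (rule integral_circ_by_parts_iterated[where u = "\<lambda>i. nth_deriv i G"])
      show "(nth_deriv i G has_field_derivative nth_deriv (Suc i) G x) (at x)" if "i < r" for i x
        using nth_deriv_has_derivative[OF diff that] .
      show "nth_deriv i G pi = nth_deriv i G (- pi)" for i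
        using nth_deriv_periodic[of G "2 * pi" i "- pi"] per by simp
      show "(v i has_field_derivative v (Suc i) x) (at x)" for i x
      proof -
        have "cos (y + (z + real (Suc i) * pi / 2)) = - sin (y + (z + real i * pi / 2))" for y z
          using minus_sin_cos_eq[of "y + (z + real i * pi / 2)"] by (simp add: algebra_simps add_divide_distrib)
        then show ?thesis unfolding v_def[abs_def]
          by (auto intro!: derivative_eq_intros simp del: of_nat_Suc)
      qed
      show "v i pi = v i (- pi)" for i unfolding v_def by (simp only: cos_periodic_npi)
      show "continuous_on UNIV (v r)" unfolding v_def[abs_def] by (intro continuous_intros)
    qed (use g1 in auto)
    also have "\<dots> = (\<integral>x. real (Suc j) ^ r * (G x * phase_cos (\<lambda>_. 0) j x) \<partial>circ)"
      unfolding vr by (cases "even r") (simp_all add: mult.left_commute)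
    also have "\<dots> = real (Suc j) ^ r * (pi * a j)"
      using cos_series_coeff[OF a, of c "\<lambda>_. 0" j] by (simp add: G)
    finally show ?thesis by (simp add: v0)
  qed
  define A where "A j = (real (Suc j) ^ r * a j)\<^sup>2" for j
  have A_nonneg: "0 \<le> A j" for j by (simp add: A_def)
  have "(\<Sum>j<N. pi * A j) \<le> (\<integral>x. (?g x)\<^sup>2 \<partial>circ)" for N
  proof -
    have "pi * (\<Sum>j<N. pi * A j) \<le> pi * (\<integral>x. (?g x)\<^sup>2 \<partial>circ)"
      using bessel_phase_cos[OF gm sq, where b = "\<lambda>_. real r * pi / 2" and N = N]
      unfolding coeff by (simp add: A_def power_mult_distrib sum_distrib_left power2_eq_square mult_ac)
    then show ?thesis by simp
  qed
  moreover from this have smpA: "summable (\<lambda>j. pi * A j)"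
    by (intro summableI_nonneg_bounded) (auto simp: A_def)
  ultimately have le: "(\<Sum>j. pi * A j) \<le> (\<integral>x. (?g x)\<^sup>2 \<partial>circ)"
    by (intro suminf_le_const)
  have smA: "summable A" using smpA by (simp add: summable_cmult_iff)
  obtain k where k: "r = Suc k" using r by (cases r) auto
  \<comment> \<open>One power of the frequency is traded for absolute summability: x y is at most
    x^2 + y^2, with x the r-th weighted coefficient (square-summable by Bessel) and y = 1 / (j +
    1).\<close>
  have sk: "summable (\<lambda>j. \<bar>real (Suc j) ^ k * a j\<bar>)"
  proof (rule summable_comparison_test')
    have "summable (\<lambda>j. inverse (real (Suc j) ^ 2))"
      using inverse_power_summable[of 2, where 'a = real] summable_Suc_iff[of "\<lambda>n. inverse (real n ^ 2)"] by simp
    then show "summable (\<lambda>j. A j + inverse (real (Suc j) ^ 2))" using smA by (intro summable_add)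
    fix j
    have "\<bar>real (Suc j) ^ k * a j\<bar> = \<bar>real (Suc j) ^ r * a j\<bar> * inverse (real (Suc j))"
      by (simp add: k abs_mult field_simps del: of_nat_Suc)
    also have "\<dots> \<le> \<bar>real (Suc j) ^ r * a j\<bar>\<^sup>2 + (inverse (real (Suc j)))\<^sup>2" (is "?x * ?y \<le> _")
    proof -
      have "0 \<le> ?x * ?y" by simp
      moreover have "2 * (?x * ?y) \<le> ?x\<^sup>2 + ?y\<^sup>2" using sum_squares_bound[of ?x ?y] by (simp only: mult.assoc)
      ultimately show ?thesis by linarith
    qed
    finally show "norm \<bar>real (Suc j) ^ k * a j\<bar> \<le> A j + inverse (real (Suc j) ^ 2)"
      by (simp add: A_def power_inverse)
  qed
  obtain c' where c': "\<And>x. nth_deriv k G x = c' + (\<Sum>j. real (Suc j) ^ k * a j * phase_cos (\<lambda>j. 0 + real k * pi / 2) j x)"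
    using nth_deriv_cos_series[OF G sk] by auto
  have dk: "(nth_deriv k G has_field_derivative ?g x) (at x)" for x
    using nth_deriv_has_derivative[OF diff, of k x] k by simp
  have Aeq: "(real (Suc j) * (real (Suc j) ^ k * a j))\<^sup>2 = A j" for j
    by (simp add: A_def k mult.assoc)
  have "(\<integral>\<^sup>+x. ennreal ((?g x)\<^sup>2) \<partial>circ) \<le> ennreal (pi * (\<Sum>j. A j))"
    using nn_integral_deriv_cos_series_le[OF c' sk dk gm] smA unfolding Aeq by blast
  then have "(\<integral>x. (?g x)\<^sup>2 \<partial>circ) \<le> pi * (\<Sum>j. A j)"
    using suminf_nonneg[OF smA] by (subst (asm) nn_integral_eq_integral[OF sq]) (simp_all add: ennreal_le_iff A_nonneg)
  with le have "(\<integral>x. (?g x)\<^sup>2 \<partial>circ) = (\<Sum>j. pi * A j)"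
    using suminf_mult[OF smA, of pi] by simp
  then show ?thesis using smpA by (simp add: A_def sums_iff)
qed

subsection \<open>Kernel moments and bias\<close>

lemma kernel_cos_series:
  assumes K: "circular_kernel_family K" and v: "v \<in> {0..<1}"
  shows "summable (\<lambda>j. \<bar>alpha K (Suc j) v / pi\<bar>)"
    and "K v x = 1 / (2 * pi) + (\<Sum>j. alpha K (Suc j) v / pi * phase_cos (\<lambda>_. 0) j x)"
proof -
  have al: "0 \<le> alpha K (Suc j) v" for j
    using K v unfolding circular_kernel_family_def by force
  have S: "summable (\<lambda>j. alpha K (Suc j) v * cos (real (Suc j) * x))"
    "K v x = 1 / (2 * pi) * (1 + 2 * (\<Sum>j. alpha K (Suc j) v * cos (real (Suc j) * x)))" for x
    using K v unfolding circular_kernel_family_def by blast+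
  have "summable (\<lambda>j. alpha K (Suc j) v)" using S(1)[of 0] by simp
  then show "summable (\<lambda>j. \<bar>alpha K (Suc j) v / pi\<bar>)" using al by (simp add: summable_divide)
  have "(\<Sum>j. alpha K (Suc j) v / pi * phase_cos (\<lambda>_. 0) j x)
      = (\<Sum>j. alpha K (Suc j) v * cos (real (Suc j) * x) / pi)"
    by (simp add: phase_cos_def)
  also have "\<dots> = (\<Sum>j. alpha K (Suc j) v * cos (real (Suc j) * x)) / pi"
    by (rule suminf_divide[OF S(1)])
  finally show "K v x = 1 / (2 * pi) + (\<Sum>j. alpha K (Suc j) v / pi * phase_cos (\<lambda>_. 0) j x)"
    using S(2)[of x] by (simp add: field_simps)
qed

text \<open>This explains the case split in \<open>R_kernel\<close>: the constant mode 1/(2 pi) of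
  the density contributes to the squared norm for r = 0 and vanishes under differentiation.\<close>

lemma R_kernel_eq_integral:
  assumes K: "circular_kernel_family K" "v \<in> {0..<1}"
    and r: "times_differentiable r (K v)" "circular_square_integrable (nth_deriv r (K v))"
  shows "R_kernel K r v = (\<integral>x. (nth_deriv r (K v) x)\<^sup>2 \<partial>circ)"
proof (cases "r = 0")
  case True
  have S: "(\<lambda>j. pi * (alpha K (Suc j) v / pi)\<^sup>2) sums ((\<integral>x. (K v x)\<^sup>2 \<partial>circ) - 2 * pi * (1 / (2 * pi))\<^sup>2)"
    using parseval_cos_series(1)[OF kernel_cos_series(1)[OF K], of "1 / (2 * pi)" "\<lambda>_. 0"]
    by (simp only: kernel_cos_series(2)[OF K, symmetric])
  have "(\<lambda>j. pi * (pi * (alpha K (Suc j) v / pi)\<^sup>2)) sums (pi * ((\<integral>x. (K v x)\<^sup>2 \<partial>circ) - 2 * pi * (1 / (2 * pi))\<^sup>2))"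
    by (rule sums_mult[OF S])
  then have "(\<Sum>j. (alpha K (Suc j) v)\<^sup>2) = pi * (\<integral>x. (K v x)\<^sup>2 \<partial>circ) - 1 / 2"
    by (simp add: sums_iff power2_eq_square right_diff_distrib)
  then show ?thesis using True by (simp add: R_kernel_def)
next
  case False
  then have S: "(\<lambda>j. pi * (real (Suc j) ^ r * (alpha K (Suc j) v / pi))\<^sup>2) sums (\<integral>x. (nth_deriv r (K v) x)\<^sup>2 \<partial>circ)"
    by (intro parseval_nth_deriv_cos_series[OF kernel_cos_series(2)[OF K] kernel_cos_series(1)[OF K] r(1) _ r(2)]) simp
  have "pi * (real (Suc j) ^ r * (alpha K (Suc j) v / pi))\<^sup>2 = real (Suc j) ^ (2 * r) * (alpha K (Suc j) v)\<^sup>2 / pi" for j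
    by (simp add: power_mult_distrib power_divide power2_eq_square power_add mult_2 del: of_nat_Suc)
  with S have S': "(\<lambda>j. real (Suc j) ^ (2 * r) * (alpha K (Suc j) v)\<^sup>2 / pi) sums (\<integral>x. (nth_deriv r (K v) x)\<^sup>2 \<partial>circ)"
    by simp
  have "(\<lambda>j. pi * (real (Suc j) ^ (2 * r) * (alpha K (Suc j) v)\<^sup>2 / pi)) sums (pi * (\<integral>x. (nth_deriv r (K v) x)\<^sup>2 \<partial>circ))"
    by (rule sums_mult[OF S'])
  then have "(\<Sum>j. real (Suc j) ^ (2 * r) * (alpha K (Suc j) v)\<^sup>2) = pi * (\<integral>x. (nth_deriv r (K v) x)\<^sup>2 \<partial>circ)"
    by (simp add: sums_iff)
  then show ?thesis using False by (simp add: R_kernel_def)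
qed

section \<open>The second moment of the kernel\<close>

lemma integral_circ_square: "(\<integral>x. x\<^sup>2 \<partial>circ) = 2 * pi ^ 3 / 3"
proof -
  have "(\<integral>x. x\<^sup>2 \<partial>circ) = pi ^ 3 / 3 - (- pi) ^ 3 / 3"
    by (rule integral_circ_FTC[where G = "\<lambda>x. x ^ 3 / 3"])
       (auto intro!: derivative_eq_intros integrable_circ_continuous continuous_intros)
  then show ?thesis by (simp add: power3_eq_cube)
qed

lemma integral_circ_square_cos:
  assumes "0 < m"
  shows "(\<integral>x. x\<^sup>2 * cos (real m * x) \<partial>circ) = 4 * pi * (-1) ^ m / (real m)\<^sup>2"
proof -
  \<comment> \<open>An antiderivative found by two integrations by parts. At both endpoints the sine
    terms vanish, and the middle term gives the value.\<close>
  let ?G = "\<lambda>x. x\<^sup>2 * sin (real m * x) / real m + 2 * x * cos (real m * x) / (real m)\<^sup>2 - 2 * sin (real m * x) / (real m) ^ 3"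
  have "(\<integral>x. x\<^sup>2 * cos (real m * x) \<partial>circ) = ?G pi - ?G (- pi)"
  proof (rule integral_circ_FTC[where G = ?G])
    show "(?G has_field_derivative x\<^sup>2 * cos (real m * x)) (at x)" for x
      using assms by (auto intro!: derivative_eq_intros simp: field_simps power2_eq_square power3_eq_cube)
    show "integrable circ (\<lambda>x. x\<^sup>2 * cos (real m * x))"
      by (intro integrable_circ_continuous continuous_intros)
  qed
  then show ?thesis by (simp add: mult.commute[of _ pi])
qed

text \<open>The constant mode of the density, paired with the square function, gives pi^2/3; the
  remaining modes are integrated term by term.\<close>

lemma h_kernel_eq_integral:
  assumes K: "circular_kernel_family K" "v \<in> {0..<1}"
  shows "h_kernel K v = (\<integral>x. x\<^sup>2 * K v x \<partial>circ)"
proof -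
  let ?a = "\<lambda>j. alpha K (Suc j) v / pi"
  let ?S = "\<lambda>x. \<Sum>j. ?a j * phase_cos (\<lambda>_. 0) j x"
  have sq: "integrable circ (\<lambda>x. x\<^sup>2)" by (intro integrable_circ_continuous continuous_intros)
  have "(\<integral>x. x\<^sup>2 * phase_cos (\<lambda>_. 0) j x \<partial>circ) = 4 * pi * (-1) ^ Suc j / (real (Suc j))\<^sup>2" for j
    using integral_circ_square_cos[of "Suc j"] unfolding phase_cos_def by simp
  then have "(\<lambda>j. ?a j * (4 * pi * (-1) ^ Suc j / (real (Suc j))\<^sup>2)) sums (\<integral>x. x\<^sup>2 * ?S x \<partial>circ)"
    using integral_mult_cos_series_sums[OF kernel_cos_series(1)[OF K] sq, of "\<lambda>_. 0"] by simp
  from sums_mult[OF this, of "1 / 4"]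
  have "(\<Sum>j. (-1) ^ Suc j * alpha K (Suc j) v / (real (Suc j))\<^sup>2) = (\<integral>x. x\<^sup>2 * ?S x \<partial>circ) / 4"
    by (simp add: sums_iff mult.commute)
  moreover have "(\<integral>x. x\<^sup>2 * K v x \<partial>circ) = (\<integral>x. 1 / (2 * pi) * x\<^sup>2 + x\<^sup>2 * ?S x \<partial>circ)"
    by (simp add: kernel_cos_series(2)[OF K] algebra_simps)
  moreover have "\<dots> = 1 / (2 * pi) * (2 * pi ^ 3 / 3) + (\<integral>x. x\<^sup>2 * ?S x \<partial>circ)"
    using sq integrable_mult_cos_series[OF kernel_cos_series(1)[OF K] sq, of "\<lambda>_. 0"]
    by (simp add: integral_circ_square)
  ultimately show ?thesis
    by (simp add: h_kernel_def power2_eq_square power3_eq_cube)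
qed

section \<open>Second-order expansion of a convolution, uniform on the circle\<close>

lemma periodic_continuous_imp_bounded_uniform:
  fixes g :: "real \<Rightarrow> real"
  assumes per: "\<And>x. g (x + 2 * pi) = g x" and cont: "continuous_on UNIV g"
  shows "\<exists>M>0. \<forall>x. \<bar>g x\<bar> \<le> M"
    and "\<forall>e>0. \<exists>d>0. \<forall>x y. \<bar>x - y\<bar> < d \<longrightarrow> \<bar>g x - g y\<bar> < e"
proof -
  have perk: "g (x + 2 * pi * of_int k) = g x" for x k
    using periodic_of_int[of g "2 * pi"] per by simp
  have red: "\<exists>k. x - 2 * pi * of_int k \<in> {0..2 * pi}" for x
    using floor_divide_lower[of "2 * pi" x] floor_divide_upper[of "2 * pi" x]
    by (intro exI[of _ "\<lfloor>x / (2 * pi)\<rfloor>"]) (auto simp: algebra_simps)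
  have gk: "g (x - 2 * pi * of_int k) = g x" for x k
    using perk[of "x - 2 * pi * of_int k" k] by simp
  have "bounded (g ` {0..2 * pi})"
    by (intro compact_imp_bounded compact_continuous_image continuous_on_subset[OF cont]) auto
  then obtain B where B: "\<And>x. x \<in> {0..2 * pi} \<Longrightarrow> \<bar>g x\<bar> \<le> B"
    unfolding bounded_iff by fastforce
  have "\<bar>g x\<bar> \<le> \<bar>B\<bar> + 1" for x
  proof -
    obtain k where "x - 2 * pi * of_int k \<in> {0..2 * pi}" using red by blast
    from B[OF this] show ?thesis by (simp add: gk)
  qed
  then show "\<exists>M>0. \<forall>x. \<bar>g x\<bar> \<le> M" by (intro exI[of _ "\<bar>B\<bar> + 1"]) auto
  show "\<forall>e>0. \<exists>d>0. \<forall>x y. \<bar>x - y\<bar> < d \<longrightarrow> \<bar>g x - g y\<bar> < e"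
  proof (intro allI impI)
    fix e :: real assume "0 < e"
    \<comment> \<open>The window exceeds one period by 1 on each side: x is reduced into the period,
      and y, shifted by the same multiple of 2 pi, stays inside as long as the distance is below 1.
      Hence \<open>min d 1\<close> below.\<close>
    moreover have "uniformly_continuous_on {-1..2 * pi + 1} g"
      by (intro compact_uniformly_continuous continuous_on_subset[OF cont]) auto
    ultimately obtain d where d: "0 < d"
      "\<And>x y. x \<in> {-1..2 * pi + 1} \<Longrightarrow> y \<in> {-1..2 * pi + 1} \<Longrightarrow> \<bar>x - y\<bar> < d \<Longrightarrow> \<bar>g x - g y\<bar> < e"
      unfolding uniformly_continuous_on_def dist_real_def by metis
    have "\<bar>g x - g y\<bar> < e" if xy: "\<bar>x - y\<bar> < min d 1" for x y
    proof -
      obtain k where "x - 2 * pi * of_int k \<in> {0..2 * pi}" using red by blast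
      with xy have "\<bar>g (x - 2 * pi * of_int k) - g (y - 2 * pi * of_int k)\<bar> < e"
        by (intro d(2)) auto
      then show ?thesis by (simp add: gk)
    qed
    then show "\<exists>d>0. \<forall>x y. \<bar>x - y\<bar> < d \<longrightarrow> \<bar>g x - g y\<bar> < e"
      using d(1) by (intro exI[of _ "min d 1"]) auto
  qed
qed

text \<open>For |u| < d the modulus of continuity of \<open>g2\<close> bounds the error. For |u| at
  least d only the bound 2 * M is available, and since u^2 / d^2 is then at least 1 it may be
  multiplied by that ratio. Adding both bounds avoids a case split in u under the integral and lets
  the fourth moment appear.\<close>

lemma taylor2_uniform:
  fixes g :: "real \<Rightarrow> real"
  assumes g: "\<And>x. (g has_field_derivative g1 x) (at x)" "\<And>x. (g1 has_field_derivative g2 x) (at x)"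
    and M: "\<And>x. \<bar>g2 x\<bar> \<le> M" and d: "0 < d" "\<And>x y. \<bar>x - y\<bar> < d \<Longrightarrow> \<bar>g2 x - g2 y\<bar> < e"
  shows "\<bar>g (t - u) - g t + u * g1 t - u\<^sup>2 / 2 * g2 t\<bar> \<le> e / 2 * u\<^sup>2 + M / d\<^sup>2 * u ^ 4"
proof (cases "u = 0")
  case False
  \<comment> \<open>Taylor's theorem of order 2 reads only the entries 0, 1 and 2 of this
    sequence.\<close>
  define D where "D = (\<lambda>m::nat. if m = 0 then g else if m = 1 then g1 else g2)"
  have "\<exists>s. (if t - u < t then t - u < s \<and> s < t else t < s \<and> s < t - u) \<and>
      g (t - u) = (\<Sum>m<2. (D m t / fact m) * (t - u - t) ^ m) + (D 2 s / fact 2) * (t - u - t)\<^sup>2"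
    using False g
    by (intro Taylor[where a = "min t (t - u)" and b = "max t (t - u)"])
       (auto simp: D_def less_2_cases_iff)
  then obtain s where s: "if t - u < t then t - u < s \<and> s < t else t < s \<and> s < t - u"
    and eq: "g (t - u) = (\<Sum>m<2. (D m t / fact m) * (t - u - t) ^ m) + (D 2 s / fact 2) * (t - u - t)\<^sup>2"
    by blast
  have s: "\<bar>s - t\<bar> < \<bar>u\<bar>" using s by (simp split: if_splits)
  have eq: "g (t - u) = g t - u * g1 t + g2 s / 2 * u\<^sup>2"
    using eq by (simp add: D_def numeral_2_eq_2)
  have e: "0 \<le> e" using d(2)[of 0 0] d(1) by simp
  have Mn: "0 \<le> M" using M[of 0] by linarith
  have "\<bar>g2 s - g2 t\<bar> \<le> e + 2 * M * (u\<^sup>2 / d\<^sup>2)"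
  proof (cases "\<bar>u\<bar> < d")
    case True
    with s have "\<bar>g2 s - g2 t\<bar> < e" by (intro d(2)) simp
    moreover have "0 \<le> 2 * M * (u\<^sup>2 / d\<^sup>2)" using Mn by simp
    ultimately show ?thesis by linarith
  next
    case False
    then have "d\<^sup>2 \<le> u\<^sup>2" using d(1) by (metis abs_le_square_iff abs_of_pos linorder_not_less)
    then have "1 \<le> u\<^sup>2 / d\<^sup>2" using d(1) by simp
    then have "2 * M * 1 \<le> 2 * M * (u\<^sup>2 / d\<^sup>2)" using Mn by (intro mult_left_mono) auto
    then show ?thesis using M[of s] M[of t] e by linarith
  qed
  then have "u\<^sup>2 / 2 * \<bar>g2 s - g2 t\<bar> \<le> u\<^sup>2 / 2 * (e + 2 * M * (u\<^sup>2 / d\<^sup>2))"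
    by (intro mult_left_mono) auto
  moreover have "g (t - u) - g t + u * g1 t - u\<^sup>2 / 2 * g2 t = u\<^sup>2 / 2 * (g2 s - g2 t)"
    using eq by (simp add: algebra_simps)
  then have "\<bar>g (t - u) - g t + u * g1 t - u\<^sup>2 / 2 * g2 t\<bar> = u\<^sup>2 / 2 * \<bar>g2 s - g2 t\<bar>"
    by (simp only: abs_mult) simp
  moreover have "u\<^sup>2 / 2 * (e + 2 * M * (u\<^sup>2 / d\<^sup>2)) = e / 2 * u\<^sup>2 + M / d\<^sup>2 * u ^ 4"
    by (simp add: algebra_simps power2_eq_square power4_eq_xxxx)
  ultimately show ?thesis by linarith
qed simp

text \<open>The Taylor bound is integrated against the probability density \<open>k\<close>: the
  zeroth-order term reproduces \<open>g t\<close>, the first-order term is odd and vanishes by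
  symmetry, and the second-order term carries the second moment.\<close>

lemma convolution_bias_bound:
  fixes g k :: "real \<Rightarrow> real"
  assumes g: "\<And>x. (g has_field_derivative g1 x) (at x)" "\<And>x. (g1 has_field_derivative g2 x) (at x)"
    and M: "\<And>x. \<bar>g2 x\<bar> \<le> M" and d: "0 < d" "\<And>x y. \<bar>x - y\<bar> < d \<Longrightarrow> \<bar>g2 x - g2 y\<bar> < e"
    and k: "circular_density k" "symmetric_about_zero k"
  shows "\<bar>(\<integral>u. k u * g (t - u) \<partial>circ) - g t - (\<integral>u. u\<^sup>2 * k u \<partial>circ) / 2 * g2 t\<bar>
    \<le> e / 2 * (\<integral>u. u\<^sup>2 * k u \<partial>circ) + M / d\<^sup>2 * (\<integral>u. u ^ 4 * k u \<partial>circ)"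
proof -
  have [measurable]: "k \<in> borel_measurable borel" and k0: "\<And>x. 0 \<le> k x" and k1: "integrable circ k" "integral\<^sup>L circ k = 1"
    using k(1) by (auto simp: circular_density_def integrable_circ integral_circ)
  have gc: "continuous_on UNIV g"
    using g(1) by (auto intro!: DERIV_isCont continuous_at_imp_continuous_on)
  have I: "integrable circ (\<lambda>u. u * k u)" "integrable circ (\<lambda>u. u\<^sup>2 * k u)" "integrable circ (\<lambda>u. u ^ 4 * k u)"
    by (rule integrable_circ_mult_continuous[OF _ k1(1)], intro continuous_intros)+
  have gtc: "continuous_on UNIV (\<lambda>u. g (t - u))"
    by (rule continuous_on_compose2[OF gc, where f = "\<lambda>u. t - u"]) (auto intro: continuous_intros)
  have "integrable circ (\<lambda>u. g (t - u) * k u)"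
    by (rule integrable_circ_mult_continuous[OF gtc k1(1)])
  with I have I: "integrable circ (\<lambda>u. u * k u)" "integrable circ (\<lambda>u. u\<^sup>2 * k u)" "integrable circ (\<lambda>u. u ^ 4 * k u)"
    "integrable circ (\<lambda>u. k u * g (t - u))"
    by (simp_all add: mult.commute)
  have "(\<integral>u. u * k u \<partial>circ) = 0"
    using integral_circ_reflect[of "\<lambda>u. u * k u"] k(2) by (simp add: symmetric_about_zero_def)
  moreover have "(\<integral>u. k u * (g (t - u) - g t + u * g1 t - u\<^sup>2 / 2 * g2 t) \<partial>circ)
      = (\<integral>u. k u * g (t - u) - g t * k u + g1 t * (u * k u) - g2 t / 2 * (u\<^sup>2 * k u) \<partial>circ)"
    by (intro Bochner_Integration.integral_cong refl) (simp add: algebra_simps)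
  ultimately have "(\<integral>u. k u * (g (t - u) - g t + u * g1 t - u\<^sup>2 / 2 * g2 t) \<partial>circ)
      = (\<integral>u. k u * g (t - u) \<partial>circ) - g t - (\<integral>u. u\<^sup>2 * k u \<partial>circ) / 2 * g2 t"
    using I k1 by simp
  moreover have "\<bar>\<integral>u. k u * (g (t - u) - g t + u * g1 t - u\<^sup>2 / 2 * g2 t) \<partial>circ\<bar>
      \<le> (\<integral>u. e / 2 * (u\<^sup>2 * k u) + M / d\<^sup>2 * (u ^ 4 * k u) \<partial>circ)"
  proof (rule order_trans[OF integral_abs_bound integral_mono_AE])
    have "integrable circ (\<lambda>u. (g (t - u) - g t + u * g1 t - u\<^sup>2 / 2 * g2 t) * k u)"
      by (rule integrable_circ_mult_continuous[OF _ k1(1)]) (auto intro!: continuous_intros gtc)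
    then show "integrable circ (\<lambda>u. \<bar>k u * (g (t - u) - g t + u * g1 t - u\<^sup>2 / 2 * g2 t)\<bar>)"
      by (simp add: mult.commute)
    show "integrable circ (\<lambda>u. e / 2 * (u\<^sup>2 * k u) + M / d\<^sup>2 * (u ^ 4 * k u))" using I by simp
    have "\<bar>k u * (g (t - u) - g t + u * g1 t - u\<^sup>2 / 2 * g2 t)\<bar> \<le> e / 2 * (u\<^sup>2 * k u) + M / d\<^sup>2 * (u ^ 4 * k u)" for u
      unfolding abs_mult abs_of_nonneg[OF k0]
      by (rule order_trans[OF mult_left_mono[OF taylor2_uniform[OF g M d] k0]]) (simp_all add: algebra_simps)
    then show "AE u in circ. \<bar>k u * (g (t - u) - g t + u * g1 t - u\<^sup>2 / 2 * g2 t)\<bar> \<le> e / 2 * (u\<^sup>2 * k u) + M / d\<^sup>2 * (u ^ 4 * k u)"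
      by simp
  qed
  ultimately show ?thesis using I by simp
qed

subsection \<open>Minimisation of the asymptotic risk\<close>

text \<open>Squaring the weak bound at x/2 leaves the surplus x^2/4. Strictness is what makes the
  minimiser unique.\<close>

lemma exp_ge_add_one_strict: "1 + x < exp x" if "x \<noteq> 0" for x :: real
proof -
  have "1 + x / 2 \<le> exp (x / 2)" by (rule exp_ge_add_one_self)
  show ?thesis
  proof (cases "1 + x \<le> 0")
    case True then show ?thesis using exp_gt_zero[of x] by linarith
  next
    case False
    then have "(1 + x / 2)\<^sup>2 \<le> (exp (x / 2))\<^sup>2"
      using \<open>1 + x / 2 \<le> exp (x / 2)\<close> by (intro power_mono) auto
    also have "\<dots> = exp x" by (simp add: power2_eq_square mult_exp_exp)
    finally have "1 + x + (x / 2)\<^sup>2 \<le> exp x" by (simp add: power2_eq_square algebra_simps)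
    moreover have "0 < (x / 2)\<^sup>2" using that by simp
    ultimately show ?thesis by linarith
  qed
qed

text \<open>\<open>hs\<close> is the zero of the derivative: I h / 2 = a C h^(-a-1). There the two
  terms have the fixed ratio a : 2, so at h = hs e^s both contain the factor I hs^2, with weights
  exp(2 s) / 4 and exp(-a s) / (2 a).\<close>

lemma square_plus_powr_minimum:
  fixes I C a h hs :: real
  assumes pos: "0 < I" "0 < C" "0 < a" "0 < h"
  defines "hs \<equiv> (2 * a * C / I) powr (1 / (a + 2))"
  shows "1 / 4 * I * hs\<^sup>2 + C * hs powr (- a) = (1 / 4 + 1 / (2 * a)) * I * hs\<^sup>2"
    and "h \<noteq> hs \<Longrightarrow> (1 / 4 + 1 / (2 * a)) * I * hs\<^sup>2 < 1 / 4 * I * h\<^sup>2 + C * h powr (- a)"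
proof -
  have hs: "0 < hs" using pos by (simp add: hs_def)
  have "hs powr (a + 2) = 2 * a * C / I"
    using pos by (simp add: hs_def powr_powr)
  then have "hs powr a * hs\<^sup>2 = 2 * a * C / I"
    using hs by (simp add: powr_add powr_numeral)
  then have C: "C * hs powr (- a) = I * hs\<^sup>2 / (2 * a)"
    using hs pos by (simp add: powr_minus field_simps)
  then show "1 / 4 * I * hs\<^sup>2 + C * hs powr (- a) = (1 / 4 + 1 / (2 * a)) * I * hs\<^sup>2"
    by (simp add: algebra_simps)
  assume ne: "h \<noteq> hs"
  define s where "s = ln (h / hs)"
  have s: "s \<noteq> 0" using ne pos hs by (simp add: s_def)
  have h: "h = hs * exp s" using pos hs by (simp add: s_def)
  have "h\<^sup>2 = hs\<^sup>2 * exp (2 * s)"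
    by (simp add: h power_mult_distrib exp_double)
  moreover have "h powr (- a) = hs powr (- a) * exp (- a * s)"
    unfolding h using hs by (subst powr_mult) (auto simp: powr_def)
  ultimately have "1 / 4 * I * h\<^sup>2 + C * h powr (- a)
      = I * hs\<^sup>2 * (exp (2 * s) / 4 + exp (- a * s) / (2 * a))"
    using arg_cong[OF C, of "\<lambda>y. y * exp (- a * s)"] by (simp add: algebra_simps)
  \<comment> \<open>In the tangent bounds the linear parts are s/2 and -s/2. They cancel, so the
    lower bound is the value at s = 0.\<close>
  also have "\<dots> > I * hs\<^sup>2 * ((1 + 2 * s) / 4 + (1 + (- a * s)) / (2 * a))"
  proof (intro mult_strict_left_mono add_strict_mono divide_strict_right_mono)
    show "1 + 2 * s < exp (2 * s)" using s by (intro exp_ge_add_one_strict) simp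
    show "1 + (- a * s) < exp (- a * s)" using s pos by (intro exp_ge_add_one_strict) simp
  qed (use pos hs in auto)
  also have "I * hs\<^sup>2 * ((1 + 2 * s) / 4 + (1 + (- a * s)) / (2 * a)) = (1 / 4 + 1 / (2 * a)) * I * hs\<^sup>2"
    using pos by (simp add: field_simps)
  finally show "(1 / 4 + 1 / (2 * a)) * I * hs\<^sup>2 < 1 / 4 * I * h\<^sup>2 + C * h powr (- a)" .
qed

text \<open>The preceding lemma with a = (2r+1)/2 and C = Q/n: then 1/(a+2) = 2/(2r+5), and 1/4 +
  1/(2a) = (2r+5)/(8r+4).\<close>

lemma
  fixes f :: "real \<Rightarrow> real" and Q :: real and r n :: nat
  defines "I \<equiv> integrated_sq_deriv f (r + 2)"
  defines "c \<equiv> (2 * real r + 1) * Q / (real n * I)"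
  assumes pos: "0 < I" "0 < Q" "0 < n"
  shows AMISE_of_h_arg_min:
      "is_arg_min (AMISE_of_h f Q r n) (\<lambda>h. 0 < h) h \<longleftrightarrow> h = c powr (2 / (2 * real r + 5))"
    and AMISE_of_h_INF:
      "(INF h\<in>{0<..}. AMISE_of_h f Q r n h) = (2 * real r + 5) / (8 * real r + 4) * c powr (4 / (2 * real r + 5)) * I"
proof -
  define a where "a = (2 * real r + 1) / 2"
  define hs where "hs = c powr (2 / (2 * real r + 5))"
  let ?m = "(1 / 4 + 1 / (2 * a)) * I * hs\<^sup>2"
  have a: "0 < a" by (simp add: a_def)
  have c: "0 < c" using pos by (simp add: c_def)
  have hs: "0 < hs" using c by (simp add: hs_def)
  have hs_eq: "hs = (2 * a * (Q / real n) / I) powr (1 / (a + 2))"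
    using pos unfolding hs_def c_def a_def by (intro arg_cong2[where f="(powr)"]) (auto simp: field_simps)
  have A: "AMISE_of_h f Q r n h = 1 / 4 * I * h\<^sup>2 + Q / real n * h powr (- a)" for h
    by (simp add: AMISE_of_h_def I_def a_def minus_divide_left)
  have at: "AMISE_of_h f Q r n hs = ?m"
    unfolding A hs_eq using pos a by (intro square_plus_powr_minimum) auto
  have other: "?m < AMISE_of_h f Q r n h" if "0 < h" "h \<noteq> hs" for h
    using square_plus_powr_minimum(2)[of I "Q / real n" a h] pos a that unfolding A hs_eq by simp
  show "is_arg_min (AMISE_of_h f Q r n) (\<lambda>h. 0 < h) h \<longleftrightarrow> h = c powr (2 / (2 * real r + 5))"
    unfolding hs_def[symmetric] is_arg_min_def using at other hs
    by (metis less_asym order_less_irrefl)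
  have "(INF h\<in>{0<..}. AMISE_of_h f Q r n h) = ?m"
  \<comment> \<open>The infimum is attained, which settles both nonemptiness and boundedness below
    for the conditionally complete \<open>INF\<close>.\<close>
  proof (rule cInf_eq_minimum)
    show "?m \<in> AMISE_of_h f Q r n ` {0<..}" using at hs by (metis image_eqI greaterThan_iff)
    show "?m \<le> x" if "x \<in> AMISE_of_h f Q r n ` {0<..}" for x
      using that at other by (metis imageE greaterThan_iff order.strict_implies_order order_refl)
  qed
  also have "hs\<^sup>2 = c powr (4 / (2 * real r + 5))"
    using c by (simp add: hs_def power2_eq_square flip: powr_add)
  also have "1 / 4 + 1 / (2 * a) = (2 * real r + 5) / (8 * real r + 4)"
    by (simp add: a_def field_simps)
  finally show "(INF h\<in>{0<..}. AMISE_of_h f Q r n h)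
      = (2 * real r + 5) / (8 * real r + 4) * c powr (4 / (2 * real r + 5)) * I"
    by (simp add: mult_ac)
qed

subsection \<open>Mean squared error\<close>

context prob_space
begin

text \<open>After centring, independence removes the off-diagonal products; n of the n^2 terms
  remain, hence the factor 1/n. The cross term with the bias has mean zero.\<close>

lemma mean_square_error_iid:
  fixes Y :: "nat \<Rightarrow> 'a \<Rightarrow> real"
  assumes indep: "indep_vars (\<lambda>_. borel) Y UNIV"
    and int: "\<And>i. integrable M (Y i)" "\<And>i. integrable M (\<lambda>x. (Y i x)\<^sup>2)"
    and mu: "\<And>i. expectation (Y i) = \<mu>" and s: "\<And>i. expectation (\<lambda>x. (Y i x)\<^sup>2) = s"
    and n: "0 < n"
  shows "expectation (\<lambda>x. (1 / real n * (\<Sum>i<n. Y i x) - c)\<^sup>2) = (s - \<mu>\<^sup>2) / real n + (\<mu> - c)\<^sup>2"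
proof -
  define Z where "Z i x = Y i x - \<mu>" for i x
  have iv: "indep_var borel (Z i) borel (Z j)" if "i \<noteq> j" for i j
  proof -
    \<comment> \<open>Independence of a pair is obtained from the disjoint index sets {i} and {j},
      by restricting the family to each and reading off its one coordinate.\<close>
    have "indep_var borel ((\<lambda>\<omega>. \<omega> i - \<mu>) \<circ> (\<lambda>\<omega>. restrict (\<lambda>i. Y i \<omega>) {i}))
        borel ((\<lambda>\<omega>. \<omega> j - \<mu>) \<circ> (\<lambda>\<omega>. restrict (\<lambda>i. Y i \<omega>) {j}))"
      using that by (intro indep_var_compose[OF indep_var_restrict[OF indep]]) auto
    then show ?thesis by (simp add: comp_def Z_def[abs_def])
  qed
  have Zi: "integrable M (Z i)" for i unfolding Z_def[abs_def] using int by simp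
  have Z0: "expectation (Z i) = 0" for i unfolding Z_def[abs_def] using int mu by (simp add: prob_space)
  have Zsq: "Z i x * Z i x = (Y i x)\<^sup>2 - 2 * \<mu> * Y i x + \<mu>\<^sup>2" for i x
    by (simp add: Z_def power2_eq_square algebra_simps)
  have ZZ: "integrable M (\<lambda>x. Z i x * Z j x)" for i j
    using Zi iv[of i j] int by (cases "i = j") (auto simp: Zsq intro!: indep_var_integrable)
  have EZZ: "expectation (\<lambda>x. Z i x * Z j x) = (if i = j then s - \<mu>\<^sup>2 else 0)" for i j
  proof (cases "i = j")
    case True
    then show ?thesis using int mu s by (simp add: Zsq prob_space power2_eq_square)
  next
    case False
    then show ?thesis using indep_var_lebesgue_integral[OF iv Zi Zi] Z0 by simp
  qed
  have eq: "1 / real n * (\<Sum>i<n. Y i x) - c = (\<Sum>i<n. Z i x) / real n + (\<mu> - c)" for x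
    using n by (simp add: Z_def sum_subtractf field_simps)
  have "expectation (\<lambda>x. (1 / real n * (\<Sum>i<n. Y i x) - c)\<^sup>2) =
     expectation (\<lambda>x. (\<Sum>i<n. \<Sum>j<n. Z i x * Z j x) / (real n)\<^sup>2 + 2 * (\<mu> - c) / real n * (\<Sum>i<n. Z i x) + (\<mu> - c)\<^sup>2)"
    unfolding eq by (intro Bochner_Integration.integral_cong refl)
       (simp only: power2_sum, simp add: power_divide power2_eq_square sum_product algebra_simps)
  also have "\<dots> = (\<Sum>i<n. \<Sum>j<n. expectation (\<lambda>x. Z i x * Z j x)) / (real n)\<^sup>2 + (\<mu> - c)\<^sup>2"
    using ZZ Zi Z0 by (simp add: prob_space)
  also have "\<dots> = (s - \<mu>\<^sup>2) / real n + (\<mu> - c)\<^sup>2"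
    using n by (simp add: EZZ power2_eq_square)
  finally show ?thesis .
qed

end

section \<open>Moments of the estimator, at a point and integrated over the circle\<close>

lemma
  fixes \<phi> :: "real \<Rightarrow> real"
  assumes f: "circular_density f" and X: "iid_circular_sample M X f" and [measurable]: "\<phi> \<in> borel_measurable borel"
  shows integrable_circular_sample: "integrable M (\<lambda>\<omega>. \<phi> (X i \<omega>)) \<longleftrightarrow> integrable circ (\<lambda>x. f x * \<phi> x)"
    and integral_circular_sample: "(\<integral>\<omega>. \<phi> (X i \<omega>) \<partial>M) = (\<integral>x. f x * \<phi> x \<partial>circ)"
proof -
  have D: "distributed M lborel (X i) (\<lambda>x. ennreal (indicator {-pi..<pi} x * f x))"
    using X by (simp add: iid_circular_sample_def)
  have f0: "0 \<le> indicator {-pi..<pi} x * f x" for x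
    using f by (auto simp: circular_density_def)
  show "integrable M (\<lambda>\<omega>. \<phi> (X i \<omega>)) \<longleftrightarrow> integrable circ (\<lambda>x. f x * \<phi> x)"
    using distributed_integrable[OF D, of \<phi>] f0 by (simp add: integrable_circ set_integrable_def mult.assoc)
  show "(\<integral>\<omega>. \<phi> (X i \<omega>) \<partial>M) = (\<integral>x. f x * \<phi> x \<partial>circ)"
    using distributed_integral[OF D, of \<phi>] f0 by (simp add: integral_circ set_lebesgue_integral_def mult.assoc)
qed

text \<open>Continuity bounds f on a period, so the second moment of k(t - X) exists at every t and
  the formula holds pointwise, not just almost everywhere.\<close>

lemma kde_mean_square_error:
  fixes k :: "real \<Rightarrow> real"
  assumes f: "circular_density f" "continuous_on UNIV f" and X: "iid_circular_sample M X f"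
    and k[measurable]: "k \<in> borel_measurable borel" and per: "\<And>x. k (x + 2 * pi) = k x"
    and sq: "integrable circ (\<lambda>x. (k x)\<^sup>2)" and n: "0 < n"
  shows "(\<integral>\<omega>. (1 / real n * (\<Sum>i<n. k (t - X i \<omega>)) - c)\<^sup>2 \<partial>M) =
     ((\<integral>x. f x * (k (t - x))\<^sup>2 \<partial>circ) - (\<integral>x. f x * k (t - x) \<partial>circ)\<^sup>2) / real n
     + ((\<integral>x. f x * k (t - x) \<partial>circ) - c)\<^sup>2"
proof -
  interpret prob_space M using X by (simp add: iid_circular_sample_def)
  have sq': "integrable circ (\<lambda>x. (k (t - x))\<^sup>2)"
    using integrable_circ_reflect_at[of "\<lambda>x. (k x)\<^sup>2" t] sq per by simp
  have "integrable circ (\<lambda>x. k (t - x))"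
    by (rule circ.square_integrable_imp_integrable[OF _ sq']) measurable
  then have I: "integrable circ (\<lambda>x. f x * k (t - x))" "integrable circ (\<lambda>x. f x * (k (t - x))\<^sup>2)"
    using sq' by (auto intro: integrable_circ_mult_continuous f(2))
  have km: "(\<lambda>x. k (t - x)) \<in> borel_measurable borel" "(\<lambda>x. (k (t - x))\<^sup>2) \<in> borel_measurable borel"
    by measurable
  have "indep_vars (\<lambda>_. borel) X UNIV" using X by (simp add: iid_circular_sample_def)
  then have "indep_vars (\<lambda>_. borel) (\<lambda>i \<omega>. k (t - X i \<omega>)) UNIV"
    by (rule indep_vars_compose2[where Y = "\<lambda>_ x. k (t - x)"]) (rule km(1))
  then show ?thesis
    using I n by (intro mean_square_error_iid[where Y = "\<lambda>i \<omega>. k (t - X i \<omega>)"])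
      (simp_all only: integrable_circular_sample[OF f(1) X km(1)] integrable_circular_sample[OF f(1) X km(2)]
         integral_circular_sample[OF f(1) X km(1)] integral_circular_sample[OF f(1) X km(2)])
qed

lemma measurable_diff_circ [measurable]: "(\<lambda>(x, y). x - y) \<in> borel_measurable (circ \<Otimes>\<^sub>M circ)"
proof -
  have "fst \<in> borel_measurable (circ \<Otimes>\<^sub>M circ)" "snd \<in> borel_measurable (circ \<Otimes>\<^sub>M circ)"
    using measurable_compose[OF measurable_fst measurable_ident_circ] measurable_compose[OF measurable_snd measurable_ident_circ]
    by auto
  then show ?thesis unfolding split_beta by (rule borel_measurable_diff)
qed

text \<open>By Tonelli the integral over t is taken first; rotation invariance makes it independent
  of x, and f integrates to one. Working with nonnegative integrals delivers integrability together
  with the value.\<close>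

lemma
  fixes k :: "real \<Rightarrow> real"
  assumes f: "circular_density f" "continuous_on UNIV f"
    and k[measurable]: "k \<in> borel_measurable borel" and per: "\<And>x. k (x + 2 * pi) = k x"
    and sq: "integrable circ (\<lambda>x. (k x)\<^sup>2)"
  shows integral_second_moment: "(\<integral>t. \<integral>x. f x * (k (t - x))\<^sup>2 \<partial>circ \<partial>circ) = (\<integral>x. (k x)\<^sup>2 \<partial>circ)"
    and integrable_second_moment: "integrable circ (\<lambda>t. \<integral>x. f x * (k (t - x))\<^sup>2 \<partial>circ)"
proof -
  interpret P: pair_sigma_finite circ circ by standard
  have [measurable]: "f \<in> borel_measurable borel" and f0: "\<And>x. 0 \<le> f x" and f1: "integrable circ f" "integral\<^sup>L circ f = 1"
    using f(1) by (auto simp: circular_density_def integrable_circ integral_circ)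
  have m2: "(\<lambda>(t, x). f x * (k (t - x))\<^sup>2) \<in> borel_measurable (circ \<Otimes>\<^sub>M circ)"
  proof -
    have "(\<lambda>z. k (case z of (t, x) \<Rightarrow> t - x)) \<in> borel_measurable (circ \<Otimes>\<^sub>M circ)"
      by (rule measurable_compose[OF measurable_diff_circ k])
    moreover have "(\<lambda>z. f (snd z)) \<in> borel_measurable (circ \<Otimes>\<^sub>M circ)"
      by (intro measurable_compose[OF measurable_snd]) measurable
    ultimately have "(\<lambda>z. f (snd z) * (k (case z of (t, x) \<Rightarrow> t - x))\<^sup>2) \<in> borel_measurable (circ \<Otimes>\<^sub>M circ)"
      by measurable
    then show ?thesis by (simp add: split_beta)
  qed
  let ?s = "\<lambda>t. \<integral>x. f x * (k (t - x))\<^sup>2 \<partial>circ"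
  have s_meas: "?s \<in> borel_measurable circ"
    by (rule circ.borel_measurable_lebesgue_integral[OF m2])
  have s0: "0 \<le> ?s t" for t using f0 by (intro Bochner_Integration.integral_nonneg) auto
  have s_nn: "ennreal (?s t) = (\<integral>\<^sup>+x. ennreal (f x * (k (t - x))\<^sup>2) \<partial>circ)" for t
  proof (rule nn_integral_eq_integral[symmetric])
    have "integrable circ (\<lambda>x. (k (t - x))\<^sup>2)"
      using integrable_circ_reflect_at[of "\<lambda>x. (k x)\<^sup>2" t] sq per by simp
    then show "integrable circ (\<lambda>x. f x * (k (t - x))\<^sup>2)" by (rule integrable_circ_mult_continuous[OF f(2)])
  qed (use f0 in auto)
  have inner: "(\<integral>\<^sup>+t. ennreal (f x * (k (t - x))\<^sup>2) \<partial>circ) = ennreal (f x) * ennreal (\<integral>x. (k x)\<^sup>2 \<partial>circ)" for x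
  proof -
    have "(\<integral>\<^sup>+t. ennreal (f x * (k (t - x))\<^sup>2) \<partial>circ) = (\<integral>\<^sup>+t. ennreal (f x) * ennreal ((k (t + - x))\<^sup>2) \<partial>circ)"
      using f0 by (simp add: ennreal_mult)
    also have "\<dots> = ennreal (f x) * (\<integral>\<^sup>+t. ennreal ((k (t + - x))\<^sup>2) \<partial>circ)"
      by (rule nn_integral_cmult) measurable
    also have "(\<integral>\<^sup>+t. ennreal ((k (t + - x))\<^sup>2) \<partial>circ) = (\<integral>\<^sup>+t. ennreal ((k t)\<^sup>2) \<partial>circ)"
      using nn_integral_circ_rotate[of "\<lambda>t. ennreal ((k t)\<^sup>2)" "- x"] per by simp
    also have "\<dots> = ennreal (\<integral>x. (k x)\<^sup>2 \<partial>circ)"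
      by (rule nn_integral_eq_integral[OF sq]) simp
    finally show ?thesis .
  qed
  have "(\<integral>\<^sup>+t. ennreal (?s t) \<partial>circ) = (\<integral>\<^sup>+x. \<integral>\<^sup>+t. ennreal (f x * (k (t - x))\<^sup>2) \<partial>circ \<partial>circ)"
    unfolding s_nn using m2 by (intro P.Fubini'[symmetric]) (simp add: split_beta)
  also have "\<dots> = (\<integral>\<^sup>+x. ennreal (f x) \<partial>circ) * ennreal (\<integral>x. (k x)\<^sup>2 \<partial>circ)"
    unfolding inner by (rule nn_integral_multc) measurable
  also have "(\<integral>\<^sup>+x. ennreal (f x) \<partial>circ) = 1"
    using f0 f1 by (subst nn_integral_eq_integral) auto
  finally have "has_bochner_integral circ ?s (\<integral>x. (k x)\<^sup>2 \<partial>circ)"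
    using s0 by (intro has_bochner_integral_nn_integral s_meas) auto
  then show "(\<integral>t. ?s t \<partial>circ) = (\<integral>x. (k x)\<^sup>2 \<partial>circ)" "integrable circ ?s"
    by (auto simp: has_bochner_integral_iff)
qed

lemma abs_integral_circ_le:
  fixes \<phi> :: "real \<Rightarrow> real"
  assumes "integrable circ \<phi>" "\<And>x. \<bar>\<phi> x\<bar> \<le> c"
  shows "\<bar>integral\<^sup>L circ \<phi>\<bar> \<le> 2 * pi * c"
proof -
  have "\<bar>integral\<^sup>L circ \<phi>\<bar> \<le> (\<integral>x. \<bar>\<phi> x\<bar> \<partial>circ)" by (rule integral_abs_bound)
  also have "\<dots> \<le> (\<integral>x. c \<partial>circ)" using assms by (intro integral_mono) auto
  finally show ?thesis by simp
qed

lemma integrable_circ_bounded: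
  fixes \<phi> :: "real \<Rightarrow> real"
  assumes "\<phi> \<in> borel_measurable circ" "\<And>x. \<bar>\<phi> x\<bar> \<le> c"
  shows "integrable circ \<phi>"
  using assms by (intro circ.integrable_const_bound[where B = c]) auto

text \<open>The derivatives move from the rough kernel to the smooth density, so that the mean of
  the estimator becomes an average of \<open>nth_deriv r f\<close>, which is bounded and can be
  expanded.\<close>

lemma kde_mean_eq_convolution:
  assumes f: "circular_density f" "times_differentiable r f" "continuous_on UNIV (nth_deriv r f)"
    and k: "times_differentiable r k" "\<And>x. k (x + 2 * pi) = k x" "circular_square_integrable (nth_deriv r k)"
  shows "(\<integral>x. f x * nth_deriv r k (t - x) \<partial>circ) = (\<integral>u. k u * nth_deriv r f (t - u) \<partial>circ)"
proof -
  have [measurable]: "f \<in> borel_measurable borel" "nth_deriv r k \<in> borel_measurable borel"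
    using f k by (auto simp: circular_density_def circular_square_integrable_def)
  have fper: "f (x + 2 * pi) = f x" for x using f(1) by (simp add: circular_density_def)
  have kper: "nth_deriv i k (x + 2 * pi) = nth_deriv i k x" for i x by (rule nth_deriv_periodic) (rule k(2))
  have fper': "nth_deriv i f (x + 2 * pi) = nth_deriv i f x" for i x by (rule nth_deriv_periodic) (rule fper)
  \<comment> \<open>The sign absorbs the inner derivative -1 of t - x, so that
    \<open>v (Suc i)\<close> is the derivative of \<open>v i\<close>; at i = r it cancels the sign
    from the integrations by parts.\<close>
  define v where "v i x = (-1) ^ i * nth_deriv i f (t - x)" for i x
  have fper2: "f (t - (x + 2 * pi)) = f (t - x)" for x
    using fper[of "t - (x + 2 * pi)"] by (metis diff_add_eq_diff_diff_swap diff_add_cancel add.commute)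
  \<comment> \<open>Writing x as t - (t - x) shows the integrand as a periodic function of t - x, to
    which the reflection lemma applies.\<close>
  have "(\<integral>x. nth_deriv r k (t - x) * f (t - (t - x)) \<partial>circ) = (\<integral>u. nth_deriv r k u * f (t - u) \<partial>circ)"
    by (rule integral_circ_reflect_at[where g = "\<lambda>u. nth_deriv r k u * f (t - u)"]) (simp_all only: kper fper2, measurable)
  then have "(\<integral>x. f x * nth_deriv r k (t - x) \<partial>circ) = (\<integral>u. nth_deriv r k u * v 0 u \<partial>circ)"
    by (simp add: v_def mult.commute)
  also have "\<dots> = (-1) ^ r * (\<integral>u. nth_deriv 0 k u * v r u \<partial>circ)"
  proof (rule integral_circ_by_parts_iterated[where u = "\<lambda>i. nth_deriv i k"])
    show "(nth_deriv i k has_field_derivative nth_deriv (Suc i) k x) (at x)" if "i < r" for i x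
      using nth_deriv_has_derivative[OF k(1) that] .
    show "integrable circ (nth_deriv r k)"
    proof (rule circ.square_integrable_imp_integrable)
      show "integrable circ (\<lambda>x. (nth_deriv r k x)\<^sup>2)"
        using k(3) by (simp add: circular_square_integrable_def integrable_circ)
    qed measurable
    show "nth_deriv i k pi = nth_deriv i k (- pi)" for i using kper[of i "- pi"] by simp
    show "(v i has_field_derivative v (Suc i) x) (at x)" if "i < r" for i x
    proof -
      have "((\<lambda>x. nth_deriv i f (t - x)) has_field_derivative nth_deriv (Suc i) f (t - x) * - 1) (at x)"
        by (rule DERIV_chain2[OF nth_deriv_has_derivative[OF f(2) that]]) (auto intro!: derivative_eq_intros)
      from DERIV_cmult[OF this, of "(-1) ^ i"] show ?thesis
        unfolding v_def[abs_def] by simp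
    qed
    have "continuous_on UNIV (\<lambda>x. nth_deriv r f (t - x))"
      by (rule continuous_on_compose2[OF f(3), where f = "\<lambda>x. t - x"]) (auto intro: continuous_intros)
    then show "continuous_on UNIV (v r)"
      unfolding v_def[abs_def] by (rule continuous_on_mult_left)
    show "v i pi = v i (- pi)" for i using fper'[of i "t - pi"] by (simp add: v_def add.commute)
  qed
  also have "\<dots> = (\<integral>u. k u * nth_deriv r f (t - u) \<partial>circ)"
    by (cases "even r") (simp_all add: v_def)
  finally show ?thesis .
qed

lemma
  fixes k g :: "real \<Rightarrow> real"
  assumes k: "circular_density k" and g: "continuous_on UNIV g" "\<And>x. \<bar>g x\<bar> \<le> B"
  shows convolution_measurable: "(\<lambda>t. \<integral>u. k u * g (t - u) \<partial>circ) \<in> borel_measurable circ"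
    and abs_convolution_le: "\<bar>\<integral>u. k u * g (t - u) \<partial>circ\<bar> \<le> B"
proof -
  have km[measurable]: "k \<in> borel_measurable borel" and k0: "\<And>x. 0 \<le> k x" and k1: "integrable circ k" "integral\<^sup>L circ k = 1"
    using k by (auto simp: circular_density_def integrable_circ integral_circ)
  have gm: "g \<in> borel_measurable borel" using g(1) by (rule borel_measurable_continuous_onI)
  have "(\<lambda>z. g (case z of (t, x) \<Rightarrow> t - x)) \<in> borel_measurable (circ \<Otimes>\<^sub>M circ)"
    by (rule measurable_compose[OF measurable_diff_circ gm])
  moreover have "(\<lambda>z. k (snd z)) \<in> borel_measurable (circ \<Otimes>\<^sub>M circ)"
    by (intro measurable_compose[OF measurable_snd]) measurable
  ultimately have "(\<lambda>z. k (snd z) * g (case z of (t, x) \<Rightarrow> t - x)) \<in> borel_measurable (circ \<Otimes>\<^sub>M circ)"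
    by measurable
  then show "(\<lambda>t. \<integral>u. k u * g (t - u) \<partial>circ) \<in> borel_measurable circ"
    by (intro circ.borel_measurable_lebesgue_integral) (simp add: split_beta)
  have gtc: "continuous_on UNIV (\<lambda>u. g (t - u))"
    by (rule continuous_on_compose2[OF g(1), where f = "\<lambda>u. t - u"]) (auto intro: continuous_intros)
  have I: "integrable circ (\<lambda>u. k u * g (t - u))"
    using integrable_circ_mult_continuous[OF gtc k1(1)] by (simp add: mult.commute)
  have "\<bar>\<integral>u. k u * g (t - u) \<partial>circ\<bar> \<le> (\<integral>u. \<bar>k u * g (t - u)\<bar> \<partial>circ)" by (rule integral_abs_bound)
  also have "\<dots> \<le> (\<integral>u. k u * B \<partial>circ)"
  proof (rule integral_mono)
    show "integrable circ (\<lambda>u. \<bar>k u * g (t - u)\<bar>)" using I by (rule integrable_abs)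
    show "integrable circ (\<lambda>u. k u * B)" using k1 by simp
    show "\<bar>k u * g (t - u)\<bar> \<le> k u * B" for u
      using k0 g(2) by (simp add: abs_mult mult_left_mono)
  qed
  finally show "\<bar>\<integral>u. k u * g (t - u) \<partial>circ\<bar> \<le> B" using k1 by simp
qed

section \<open>The exact MISE and its leading part\<close>

lemma MISE_decomposition:
  assumes f: "circular_density f" "times_differentiable r f" "continuous_on UNIV f" "continuous_on UNIV (nth_deriv r f)"
    and X: "iid_circular_sample M X f" and n: "0 < n"
    and k: "circular_density (K v)" "times_differentiable r (K v)" "circular_square_integrable (nth_deriv r (K v))"
  defines "\<mu> \<equiv> \<lambda>t. \<integral>u. K v u * nth_deriv r f (t - u) \<partial>circ"
  shows "MISE M X f K r n v = ((\<integral>x. (nth_deriv r (K v) x)\<^sup>2 \<partial>circ) - (\<integral>t. (\<mu> t)\<^sup>2 \<partial>circ)) / real n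
    + (\<integral>t. (\<mu> t - nth_deriv r f t)\<^sup>2 \<partial>circ)"
proof -
  let ?k = "nth_deriv r (K v)" and ?g = "nth_deriv r f"
  have per: "f (x + 2 * pi) = f x" "K v (x + 2 * pi) = K v x" for x
    using f k by (auto simp: circular_density_def)
  have kper: "?k (x + 2 * pi) = ?k x" for x by (rule nth_deriv_periodic) (rule per)
  have gper: "?g (x + 2 * pi) = ?g x" for x by (rule nth_deriv_periodic) (rule per)
  have km: "?k \<in> borel_measurable borel" and sq: "integrable circ (\<lambda>x. (?k x)\<^sup>2)"
    using k by (auto simp: circular_square_integrable_def integrable_circ)
  obtain B where B: "\<And>x. \<bar>?g x\<bar> \<le> B"
    using periodic_continuous_imp_bounded_uniform(1)[OF gper f(4)] by blast
  have \<mu>m[measurable]: "\<mu> \<in> borel_measurable circ" and \<mu>B: "\<bar>\<mu> t\<bar> \<le> B" for t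
    unfolding \<mu>_def using convolution_measurable[OF k(1) f(4) B] abs_convolution_le[OF k(1) f(4) B] by auto
  have [measurable]: "?g \<in> borel_measurable borel" using f(4) by (rule borel_measurable_continuous_onI)
  have I1: "integrable circ (\<lambda>t. (\<mu> t)\<^sup>2)"
  proof (rule integrable_circ_bounded[where c = "B\<^sup>2"])
    show "\<bar>(\<mu> t)\<^sup>2\<bar> \<le> B\<^sup>2" for t
      using power_mono[OF \<mu>B[of t], of 2] by simp
  qed measurable
  have I2: "integrable circ (\<lambda>t. (\<mu> t - ?g t)\<^sup>2)"
  proof (rule integrable_circ_bounded[where c = "(2 * B)\<^sup>2"])
    show "\<bar>(\<mu> t - ?g t)\<^sup>2\<bar> \<le> (2 * B)\<^sup>2" for t
      using power_mono[of "\<bar>\<mu> t - ?g t\<bar>" "2 * B" 2] \<mu>B[of t] B[of t] by simp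
  qed measurable
  let ?s = "\<lambda>t. \<integral>x. f x * (?k (t - x))\<^sup>2 \<partial>circ"
  have "MISE M X f K r n v = (\<integral>t. (?s t - (\<mu> t)\<^sup>2) / real n + (\<mu> t - ?g t)\<^sup>2 \<partial>circ)"
    unfolding MISE_def integral_circ[symmetric] kde_deriv_def \<mu>_def
      kde_mean_square_error[OF f(1,3) X km kper sq n] kde_mean_eq_convolution[OF f(1,2,4) k(2) per(2) k(3)] ..
  also have "\<dots> = ((\<integral>x. (?k x)\<^sup>2 \<partial>circ) - (\<integral>t. (\<mu> t)\<^sup>2 \<partial>circ)) / real n + (\<integral>t. (\<mu> t - ?g t)\<^sup>2 \<partial>circ)"
    using I1 I2 integrable_second_moment[OF f(1,3) km kper sq] integral_second_moment[OF f(1,3) km kper sq]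
    by simp
  finally show ?thesis .
qed

text \<open>The two terms of the error scale are served separately: the squared-bias error stays
  below c h^2, and the neglected part of the variance below c R / n.\<close>

lemma MISE_minus_AMISE_smallo:
  fixes M :: "'a measure" and \<nu> :: "nat \<Rightarrow> real"
  assumes density: "circular_density f"
    and sample: "iid_circular_sample M X f"
    and kernel: "circular_kernel_family K"
    and \<nu>_range: "\<And>n. \<nu> n \<in> {0..<1}"
    and f: "times_differentiable (r + 2) f" "continuous_on UNIV (nth_deriv (r + 2) f)"
    and K: "\<And>v. v \<in> {0..<1} \<Longrightarrow>
        times_differentiable r (K v) \<and> circular_square_integrable (nth_deriv r (K v))"
    and R: "filterlim (\<lambda>n. R_kernel K r (\<nu> n)) at_top sequentially"
    and m4: "(\<lambda>n. LBINT \<theta>:{-pi..<pi}. \<theta> ^ 4 * K (\<nu> n) \<theta>) \<in> o(\<lambda>n. h_kernel K (\<nu> n))"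
  shows "(\<lambda>n. MISE M X f K r n (\<nu> n) - AMISE f K r n (\<nu> n))
       \<in> o(\<lambda>n. (h_kernel K (\<nu> n))\<^sup>2 + 1 / real n * R_kernel K r (\<nu> n))"
proof (rule landau_o.smallI)
  fix c :: real assume c: "0 < c"
  define g where "g = nth_deriv r f"
  define g2 where "g2 = nth_deriv (r + 2) f"
  have f_per: "f (x + 2 * pi) = f x" for x using density by (simp add: circular_density_def)
  have f_diff: "(nth_deriv k f has_field_derivative nth_deriv (Suc k) f x) (at x)" if "k < r + 2" for k x
    using nth_deriv_has_derivative[OF f(1) that] .
  have f_cont: "continuous_on UNIV (nth_deriv k f)" if "k < r + 2" for k
    using f_diff[OF that] by (auto intro!: DERIV_isCont continuous_at_imp_continuous_on)
  have f_cont0: "continuous_on UNIV f" using f_cont[of 0] by simp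
  have f_diff_r: "times_differentiable r f" using f(1) by (simp add: times_differentiable_def)
  have g_cont: "continuous_on UNIV g" unfolding g_def using f_cont[of r] by simp
  have g2_cont: "continuous_on UNIV g2" unfolding g2_def using f(2) .
  have g_per: "g (x + 2 * pi) = g x" "g2 (x + 2 * pi) = g2 x" for x
    unfolding g_def g2_def by (rule nth_deriv_periodic, rule f_per)+
  have g1: "(g has_field_derivative nth_deriv (Suc r) f x) (at x)" for x
    unfolding g_def using f_diff[of r] by simp
  have g2: "(nth_deriv (Suc r) f has_field_derivative g2 x) (at x)" for x
    unfolding g2_def using f_diff[of "Suc r"] by simp
  obtain G where G: "\<And>x. \<bar>g x\<bar> \<le> G"
    using periodic_continuous_imp_bounded_uniform(1)[OF g_per(1) g_cont] by blast
  obtain B where B: "0 < B" "\<And>x. \<bar>g2 x\<bar> \<le> B"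
    using periodic_continuous_imp_bounded_uniform(1)[OF g_per(2) g2_cont] by blast
  \<comment> \<open>The second entry makes 2 pi e (1 + B) at most \<open>c\<close>, which is what
    the squared bias costs after integration over a period. The first entry allows e + B to be
    replaced by 1 + B.\<close>
  define e where "e = min 1 (c / (2 * pi * (1 + B)))"
  have e: "0 < e" "e \<le> 1" using c B by (auto simp: e_def)
  have "e \<le> c / (2 * pi * (1 + B))" by (simp add: e_def)
  then have ec: "2 * pi * (e * (1 + B)) \<le> c" using B by (simp add: pos_le_divide_eq mult_ac)
  obtain d where d: "0 < d" "\<And>x y. \<bar>x - y\<bar> < d \<Longrightarrow> \<bar>g2 x - g2 y\<bar> < e"
    using periodic_continuous_imp_bounded_uniform(2)[OF g_per(2) g2_cont] e(1) by metis
  \<comment> \<open>With this tolerance in (E1) the fourth-moment term, whose coefficient is B /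
    d^2, is at most e/2 times h, matching the second-moment term.\<close>
  have "0 < e * d\<^sup>2 / (2 * B)" using e d B by simp
  from landau_o.smallD[OF m4 this]
  have ev1: "\<forall>\<^sub>F n in sequentially. \<bar>\<integral>\<theta>. \<theta> ^ 4 * K (\<nu> n) \<theta> \<partial>circ\<bar> \<le> e * d\<^sup>2 / (2 * B) * \<bar>h_kernel K (\<nu> n)\<bar>"
    by (simp add: integral_circ)
  \<comment> \<open>From this threshold on, c R exceeds 2 pi G^2, the bound for the integral of the
    squared mean.\<close>
  have ev2: "\<forall>\<^sub>F n in sequentially. 2 * pi * G\<^sup>2 / c \<le> R_kernel K r (\<nu> n)"
    using R by (simp add: filterlim_at_top)
  show "\<forall>\<^sub>F n in sequentially. norm (MISE M X f K r n (\<nu> n) - AMISE f K r n (\<nu> n))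
      \<le> c * norm ((h_kernel K (\<nu> n))\<^sup>2 + 1 / real n * R_kernel K r (\<nu> n))"
    using ev1 ev2 eventually_gt_at_top[of 0]
  proof eventually_elim
    case (elim n)
    define v where "v = \<nu> n"
    define k where "k = K v"
    define h where "h = h_kernel K v"
    define R where "R = R_kernel K r v"
    define \<mu> where "\<mu> t = (\<integral>u. k u * g (t - u) \<partial>circ)" for t
    define b where "b t = \<mu> t - g t" for t
    have v: "v \<in> {0..<1}" using \<nu>_range by (simp add: v_def)
    have k: "circular_density k" "symmetric_about_zero k"
      using kernel v by (auto simp: circular_kernel_family_def k_def)
    have kr: "times_differentiable r k" "circular_square_integrable (nth_deriv r k)"
      using K[OF v] by (auto simp: k_def)
    have k0: "0 \<le> k x" for x using k(1) by (simp add: circular_density_def)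
    have h_eq: "h = (\<integral>u. u\<^sup>2 * k u \<partial>circ)"
      unfolding h_def k_def by (rule h_kernel_eq_integral[OF kernel v])
    have h0: "0 \<le> h" unfolding h_eq using k0 by (intro Bochner_Integration.integral_nonneg) auto
    have R_eq: "R = (\<integral>x. (nth_deriv r k x)\<^sup>2 \<partial>circ)"
      unfolding R_def k_def by (rule R_kernel_eq_integral[OF kernel v]) (use kr in \<open>simp_all add: k_def\<close>)
    have \<mu>m[measurable]: "\<mu> \<in> borel_measurable circ" and \<mu>G: "\<bar>\<mu> t\<bar> \<le> G" for t
      unfolding \<mu>_def using convolution_measurable[OF k(1) g_cont G] abs_convolution_le[OF k(1) g_cont G] by auto
    have [measurable]: "g \<in> borel_measurable borel" "g2 \<in> borel_measurable borel"
      using g_cont g2_cont by (auto intro: borel_measurable_continuous_onI)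
    have dev: "\<bar>b t - h / 2 * g2 t\<bar> \<le> e * h" for t
    proof -
      have "\<bar>b t - h / 2 * g2 t\<bar> \<le> e / 2 * h + B / d\<^sup>2 * (\<integral>u. u ^ 4 * k u \<partial>circ)"
        unfolding b_def \<mu>_def h_eq by (rule convolution_bias_bound[OF g1 g2 B(2) d k])
      also have "B / d\<^sup>2 * (\<integral>u. u ^ 4 * k u \<partial>circ) \<le> B / d\<^sup>2 * (e * d\<^sup>2 / (2 * B) * h)"
        using elim(1) h0 B(1) by (intro mult_left_mono) (auto simp: k_def h_def v_def)
      also have "\<dots> = e / 2 * h" using B(1) d(1) by simp
      finally show ?thesis by simp
    qed
    \<comment> \<open>A difference of squares: one factor is the deviation, at most e h, and the
      other is at most (e + B) h. The product is therefore of order e h^2.\<close>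
    have sq: "\<bar>(b t)\<^sup>2 - h\<^sup>2 / 4 * (g2 t)\<^sup>2\<bar> \<le> e * (1 + B) * h\<^sup>2" for t
    proof -
      have "\<bar>h * g2 t\<bar> \<le> h * B" using B(2)[of t] h0 by (simp add: abs_mult mult_left_mono)
      moreover have "b t + h / 2 * g2 t = (b t - h / 2 * g2 t) + h * g2 t" by simp
      ultimately have s: "\<bar>b t + h / 2 * g2 t\<bar> \<le> e * h + h * B" using dev[of t] by linarith
      have "(b t)\<^sup>2 - h\<^sup>2 / 4 * (g2 t)\<^sup>2 = (b t - h / 2 * g2 t) * (b t + h / 2 * g2 t)"
        by (simp add: power2_eq_square algebra_simps)
      then have "\<bar>(b t)\<^sup>2 - h\<^sup>2 / 4 * (g2 t)\<^sup>2\<bar> = \<bar>b t - h / 2 * g2 t\<bar> * \<bar>b t + h / 2 * g2 t\<bar>"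
        by (simp only: abs_mult)
      also have "\<dots> \<le> (e * h) * (e * h + h * B)"
        using dev[of t] s by (intro mult_mono) (use e h0 in auto)
      also have "\<dots> = e * (e + B) * h\<^sup>2" by (simp add: power2_eq_square algebra_simps)
      also have "\<dots> \<le> e * (1 + B) * h\<^sup>2" using e by (intro mult_right_mono mult_left_mono) auto
      finally show ?thesis .
    qed
    have I\<mu>: "integrable circ (\<lambda>t. (\<mu> t)\<^sup>2)"
    proof (rule integrable_circ_bounded[where c = "G\<^sup>2"])
      show "\<bar>(\<mu> t)\<^sup>2\<bar> \<le> G\<^sup>2" for t using power_mono[OF \<mu>G[of t], of 2] by simp
    qed measurable
    have Ig2: "integrable circ (\<lambda>t. (g2 t)\<^sup>2)"
      using g2_cont by (intro integrable_circ_continuous continuous_on_power)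
    have Ib: "integrable circ (\<lambda>t. (b t)\<^sup>2)"
    proof (rule integrable_circ_bounded[where c = "(2 * G)\<^sup>2"])
      show "\<bar>(b t)\<^sup>2\<bar> \<le> (2 * G)\<^sup>2" for t
        using power_mono[of "\<bar>b t\<bar>" "2 * G" 2] \<mu>G[of t] G[of t] by (simp add: b_def)
    qed (unfold b_def, measurable)
    have bias: "\<bar>(\<integral>t. (b t)\<^sup>2 \<partial>circ) - h\<^sup>2 / 4 * (\<integral>t. (g2 t)\<^sup>2 \<partial>circ)\<bar> \<le> c * h\<^sup>2"
    proof -
      have "(\<integral>t. (b t)\<^sup>2 \<partial>circ) - h\<^sup>2 / 4 * (\<integral>t. (g2 t)\<^sup>2 \<partial>circ) = (\<integral>t. (b t)\<^sup>2 - h\<^sup>2 / 4 * (g2 t)\<^sup>2 \<partial>circ)"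
        using Ib Ig2 by simp
      also have "\<bar>\<dots>\<bar> \<le> 2 * pi * (e * (1 + B) * h\<^sup>2)"
        using Ib Ig2 by (intro abs_integral_circ_le sq) auto
      also have "\<dots> \<le> c * h\<^sup>2" using mult_right_mono[OF ec zero_le_power2[of h]] by (simp only: mult.assoc)
      finally show ?thesis .
    qed
    have var: "\<bar>\<integral>t. (\<mu> t)\<^sup>2 \<partial>circ\<bar> \<le> c * R"
    proof -
      have "\<bar>\<integral>t. (\<mu> t)\<^sup>2 \<partial>circ\<bar> \<le> 2 * pi * G\<^sup>2"
      proof (rule abs_integral_circ_le[OF I\<mu>])
        show "\<bar>(\<mu> t)\<^sup>2\<bar> \<le> G\<^sup>2" for t using power_mono[OF \<mu>G[of t], of 2] by simp
      qed
      also have "\<dots> \<le> c * R"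
        using elim(2) c by (simp add: R_def v_def pos_divide_le_eq mult.commute)
      finally show ?thesis .
    qed
    have "MISE M X f K r n v = (R - (\<integral>t. (\<mu> t)\<^sup>2 \<partial>circ)) / real n + (\<integral>t. (b t)\<^sup>2 \<partial>circ)"
      using MISE_decomposition[where K = K and v = v, OF density f_diff_r f_cont0 g_cont[unfolded g_def] sample elim(3) k(1)[unfolded k_def] kr[unfolded k_def]]
      by (simp add: R_eq \<mu>_def b_def g_def k_def)
    moreover have "AMISE f K r n v = h\<^sup>2 / 4 * (\<integral>t. (g2 t)\<^sup>2 \<partial>circ) + R / real n"
      by (simp add: AMISE_def h_def R_def integrated_sq_deriv_def integral_circ g2_def)
    ultimately have "MISE M X f K r n v - AMISE f K r n v =
        ((\<integral>t. (b t)\<^sup>2 \<partial>circ) - h\<^sup>2 / 4 * (\<integral>t. (g2 t)\<^sup>2 \<partial>circ)) - (\<integral>t. (\<mu> t)\<^sup>2 \<partial>circ) / real n"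
      by (simp add: diff_divide_distrib)
    also have "\<bar>\<dots>\<bar> \<le> c * h\<^sup>2 + c * R / real n"
    proof -
      have "\<bar>(\<integral>t. (\<mu> t)\<^sup>2 \<partial>circ) / real n\<bar> \<le> c * R / real n"
        using divide_right_mono[OF var, of "real n"] by simp
      with bias show ?thesis by linarith
    qed
    also have "\<dots> = c * (h\<^sup>2 + 1 / real n * R)" by (simp add: algebra_simps)
    also have "\<dots> \<le> c * \<bar>h\<^sup>2 + 1 / real n * R\<bar>" using c by (intro mult_left_mono) auto
    finally show ?case by (simp add: h_def R_def v_def)
  qed
qed

text \<open>Replacing one of two nonnegative summands by an asymptotically equal one preserves
  asymptotic equality of the sum. Nonnegativity excludes cancellation, which could magnify the
  relative error.\<close>

lemma AMISE_asymp_equiv_AMISE_of_h: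
  assumes I: "0 \<le> integrated_sq_deriv f (r + 2)" and Q: "0 < Q"
    and E3: "(\<lambda>n. R_kernel K r (\<nu> n)) \<sim>[sequentially]
               (\<lambda>n. Q * h_kernel K (\<nu> n) powr (- (2 * real r + 1) / 2))"
  shows "(\<lambda>n. AMISE f K r n (\<nu> n)) \<sim>[sequentially] (\<lambda>n. AMISE_of_h f Q r n (h_kernel K (\<nu> n)))"
proof (rule smallo_imp_asymp_equiv, rule landau_o.smallI)
  fix c :: real assume c: "0 < c"
  from landau_o.smallD[OF asymp_equiv_imp_diff_smallo[OF E3] c]
  show "\<forall>\<^sub>F n in sequentially. norm (AMISE f K r n (\<nu> n) - AMISE_of_h f Q r n (h_kernel K (\<nu> n)))
      \<le> c * norm (AMISE_of_h f Q r n (h_kernel K (\<nu> n)))"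
  proof eventually_elim
    case (elim n)
    define P where "P = Q * h_kernel K (\<nu> n) powr (- (2 * real r + 1) / 2)"
    define A where "A = 1 / 4 * (h_kernel K (\<nu> n))\<^sup>2 * integrated_sq_deriv f (r + 2)"
    have P: "0 \<le> P" and A: "0 \<le> A" using Q I by (auto simp: P_def A_def)
    have "\<bar>R_kernel K r (\<nu> n) - P\<bar> \<le> c * P" using elim P by (simp add: P_def)
    then have "1 / real n * \<bar>R_kernel K r (\<nu> n) - P\<bar> \<le> 1 / real n * (c * P)"
      by (intro mult_left_mono) auto
    \<comment> \<open>The squared-bias term is added on the right only; being nonnegative, it can
      only weaken the bound.\<close>
    also have "\<dots> \<le> c * (A + 1 / real n * P)" using A c by (simp add: algebra_simps)
    also have "\<dots> = c * \<bar>A + 1 / real n * P\<bar>" using A P by simp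
    finally have "\<bar>1 / real n * (R_kernel K r (\<nu> n) - P)\<bar> \<le> c * \<bar>A + 1 / real n * P\<bar>"
      by (simp add: abs_mult)
    moreover have "AMISE f K r n (\<nu> n) - AMISE_of_h f Q r n (h_kernel K (\<nu> n)) = 1 / real n * (R_kernel K r (\<nu> n) - P)"
      by (simp add: AMISE_def AMISE_of_h_def P_def algebra_simps diff_divide_distrib)
    moreover have "AMISE_of_h f Q r n (h_kernel K (\<nu> n)) = A + 1 / real n * P"
      by (simp add: AMISE_of_h_def A_def P_def mult_ac)
    ultimately show ?case by simp
  qed
qed

theorem corollary1:
  fixes M :: "'a measure" and X :: "nat \<Rightarrow> 'a \<Rightarrow> real"
    and f :: "real \<Rightarrow> real" and K :: "real \<Rightarrow> real \<Rightarrow> real"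
    and \<nu> :: "nat \<Rightarrow> real" and r :: nat and Q :: real
  assumes density: "circular_density f"
    and sample: "iid_circular_sample M X f"
    and kernel: "circular_kernel_family K"
    and \<nu>_range: "\<And>n. \<nu> n \<in> {0..<1}"
    and A1: "times_differentiable (r + 2) f"
            "continuous_on UNIV (nth_deriv (r + 2) f)"
            "circular_square_integrable (nth_deriv (r + 2) f)"
            "(LBINT \<theta>:{-pi..<pi}. (nth_deriv (r + 2) f \<theta>)\<^sup>2) > 0"
    and A2: "\<And>v. v \<in> {0..<1} \<Longrightarrow>
               bounded (range (K v)) \<and> circular_density (K v) \<and> symmetric_about_zero (K v) \<and>
               circular_unimodal (K v) \<and> times_differentiable r (K v) \<and>
               circular_square_integrable (nth_deriv r (K v))"
    and A3: "(\<lambda>n. h_kernel K (\<nu> n)) \<longlonglongrightarrow> 0"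
            "filterlim (\<lambda>n. R_kernel K r (\<nu> n)) at_top sequentially"
            "(\<lambda>n. 1 / real n * R_kernel K r (\<nu> n)) \<longlonglongrightarrow> 0"
    and E1: "(\<lambda>n. LBINT \<theta>:{-pi..<pi}. \<theta> ^ 4 * K (\<nu> n) \<theta>) \<in> o(\<lambda>n. h_kernel K (\<nu> n))"
    and E2: "(\<lambda>n. LBINT \<theta>:{-pi..<pi}. \<theta>\<^sup>2 * (nth_deriv r (K (\<nu> n)) \<theta>)\<^sup>2)
               \<in> o(\<lambda>n. R_kernel K r (\<nu> n))"
    and E3: "(\<lambda>n. R_kernel K r (\<nu> n)) \<sim>[sequentially]
               (\<lambda>n. Q * h_kernel K (\<nu> n) powr (- (2 * real r + 1) / 2))"
  shows
    "(\<lambda>n. MISE M X f K r n (\<nu> n) - AMISE f K r n (\<nu> n))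
       \<in> o(\<lambda>n. (h_kernel K (\<nu> n))\<^sup>2 + 1 / real n * R_kernel K r (\<nu> n)) \<and>
     (\<lambda>n. AMISE f K r n (\<nu> n)) \<sim>[sequentially] (\<lambda>n. AMISE_of_h f Q r n (h_kernel K (\<nu> n))) \<and>
     (\<forall>n\<ge>1. \<forall>h. is_arg_min (AMISE_of_h f Q r n) (\<lambda>h. 0 < h) h \<longleftrightarrow>
        h = ((2 * real r + 1) * Q /
              (real n * (LBINT \<theta>:{-pi..<pi}. (nth_deriv (r + 2) f \<theta>)\<^sup>2))) powr (2 / (2 * real r + 5))) \<and>
     (\<forall>n\<ge>1. (INF h\<in>{0<..}. AMISE_of_h f Q r n h) =
        (2 * real r + 5) / (8 * real r + 4) *
        ((2 * real r + 1) * Q /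
              (real n * (LBINT \<theta>:{-pi..<pi}. (nth_deriv (r + 2) f \<theta>)\<^sup>2))) powr (4 / (2 * real r + 5)) *
        (LBINT \<theta>:{-pi..<pi}. (nth_deriv (r + 2) f \<theta>)\<^sup>2))"
proof (intro conjI)
  have I_eq: "integrated_sq_deriv f (r + 2) = (LBINT \<theta>:{-pi..<pi}. (nth_deriv (r + 2) f \<theta>)\<^sup>2)"
    by (simp only: integrated_sq_deriv_def)
  then have I: "0 < integrated_sq_deriv f (r + 2)" using A1(4) by simp
  \<comment> \<open>Positivity is forced: if Q were nonpositive, the right side P of (E3) would be
    too, and |R - P| at most |P|/2 would give R at most P/2, hence at most 0, although R tends to
    infinity.\<close>
  have Q: "0 < Q"
  proof (rule ccontr)
    assume "\<not> 0 < Q"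
    then have nonpos: "Q * h_kernel K (\<nu> n) powr (- (2 * real r + 1) / 2) \<le> 0" for n
      by (intro mult_nonpos_nonneg) auto
    have "\<forall>\<^sub>F n in sequentially. norm (R_kernel K r (\<nu> n) - Q * h_kernel K (\<nu> n) powr (- (2 * real r + 1) / 2))
        \<le> 1 / 2 * norm (Q * h_kernel K (\<nu> n) powr (- (2 * real r + 1) / 2))"
      by (rule landau_o.smallD[OF asymp_equiv_imp_diff_smallo[OF E3]]) simp
    moreover have "\<forall>\<^sub>F n in sequentially. 1 \<le> R_kernel K r (\<nu> n)"
      using A3(2) by (simp add: filterlim_at_top)
    ultimately have "\<forall>\<^sub>F n in sequentially. False"
    proof eventually_elim
      case (elim n)
      then show False using nonpos[of n] unfolding real_norm_def by linarith
    qed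
    then show False by simp
  qed
  show "(\<lambda>n. MISE M X f K r n (\<nu> n) - AMISE f K r n (\<nu> n))
       \<in> o(\<lambda>n. (h_kernel K (\<nu> n))\<^sup>2 + 1 / real n * R_kernel K r (\<nu> n))"
    using A2 by (intro MISE_minus_AMISE_smallo[OF density sample kernel \<nu>_range A1(1,2) _ A3(2) E1]) auto
  show "(\<lambda>n. AMISE f K r n (\<nu> n)) \<sim>[sequentially] (\<lambda>n. AMISE_of_h f Q r n (h_kernel K (\<nu> n)))"
    using I by (intro AMISE_asymp_equiv_AMISE_of_h[OF _ Q E3]) simp
  show "\<forall>n\<ge>1. \<forall>h. is_arg_min (AMISE_of_h f Q r n) (\<lambda>h. 0 < h) h \<longleftrightarrow>
        h = ((2 * real r + 1) * Q /
              (real n * (LBINT \<theta>:{-pi..<pi}. (nth_deriv (r + 2) f \<theta>)\<^sup>2))) powr (2 / (2 * real r + 5))"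
    unfolding I_eq[symmetric] by (intro allI impI AMISE_of_h_arg_min[OF I Q]) simp
  show "\<forall>n\<ge>1. (INF h\<in>{0<..}. AMISE_of_h f Q r n h) =
        (2 * real r + 5) / (8 * real r + 4) *
        ((2 * real r + 1) * Q /
              (real n * (LBINT \<theta>:{-pi..<pi}. (nth_deriv (r + 2) f \<theta>)\<^sup>2))) powr (4 / (2 * real r + 5)) *
        (LBINT \<theta>:{-pi..<pi}. (nth_deriv (r + 2) f \<theta>)\<^sup>2)"
    unfolding I_eq[symmetric] by (intro allI impI AMISE_of_h_INF[OF I Q]) simp
qed

end
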